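(* There exists a computable learner $\mathcal{L}:2^{<\omega}\to\mathbb{N}$ which partially succeeds on every computable probability measure on $2^{\omega}$.
   Context: Reals are elements of $2^\omega$; $X\upharpoonright n$ denotes the first $n$ bits of $X$. Fix a uniform effective enumeration $(\mu_e)_{e\in\mathbb{N}}$ of all partial computable measures on $2^\omega$; $\mu_e$ is a computable measure if it is total. For a computable measure $\mu$, $X$ is $\mu$-random if it is Martin-Löf random with respect to $\mu$. A learner $\mathcal{L}$ partially succeeds on a computable measure $\mu$ if for every $\mu$-random $X$ there is $j_0$ such that (a) $\mathcal{L}(X\upharpoonright n)=j_0$ for infinitely many $n$; (b) for each $j\ne j_0$ there are only finitely many $n$ with $\mathcal{L}(X\upharpoonright n)=j$; (c) $\mu_{j_0}$ is a (total) computable measure and $X$ is $\mu_{j_0}$-random. *)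

theory Defs
  imports "HOL-Probability.Probability" "HOL-Library.Nat_Bijection"
begin

text \<open>
  Unary partial recursive functions, with tuples coded by \<^const>\<open>prod_encode\<close>: the closure of the
  base functions under pairing, composition, primitive recursion and unbounded minimisation.
\<close>

datatype code =
    CZero | CSucc | CFst | CSnd
  | CPair code code | CComp code code | CPrec code code | CMin code

text \<open>In \<open>CMin f\<close> all values before the first zero must be defined (and nonzero).\<close>

primrec eval :: "code \<Rightarrow> nat \<rightharpoonup> nat" where
  "eval CZero = (\<lambda>x. Some 0)"
| "eval CSucc = (\<lambda>x. Some (Suc x))"
| "eval CFst = (\<lambda>x. Some (fst (prod_decode x)))"
| "eval CSnd = (\<lambda>x. Some (snd (prod_decode x)))"
| "eval (CPair f g) = (\<lambda>x. Option.bind (eval f x) (\<lambda>a.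
     Option.bind (eval g x) (\<lambda>b. Some (prod_encode (a, b)))))"
| "eval (CComp f g) = (\<lambda>x. Option.bind (eval g x) (eval f))"
| "eval (CPrec f g) = (\<lambda>x. case prod_decode x of (a, n) \<Rightarrow>
     rec_nat (eval f a)
       (\<lambda>m r. Option.bind r (\<lambda>v. eval g (prod_encode (a, prod_encode (m, v))))) n)"
| "eval (CMin f) = (\<lambda>x.
     if \<exists>n. eval f (prod_encode (x, n)) = Some 0 \<and>
            (\<forall>m<n. \<exists>y. eval f (prod_encode (x, m)) = Some (Suc y))
     then Some (LEAST n. eval f (prod_encode (x, n)) = Some 0)
     else None)"

primrec goedel :: "code \<Rightarrow> nat" where
  "goedel CZero = 0"
| "goedel CSucc = 1"
| "goedel CFst = 2"
| "goedel CSnd = 3"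
| "goedel (CPair f g) = 4 + 4 * prod_encode (goedel f, goedel g)"
| "goedel (CComp f g) = 5 + 4 * prod_encode (goedel f, goedel g)"
| "goedel (CPrec f g) = 6 + 4 * prod_encode (goedel f, goedel g)"
| "goedel (CMin f) = 7 + 4 * goedel f"

lemma goedel_inj: "goedel c = goedel d \<Longrightarrow> c = d"
proof (induction c arbitrary: d)
  case CZero then show ?case by (cases d) auto
next
  case CSucc then show ?case by (cases d) auto
next
  case CFst then show ?case by (cases d) auto
next
  case CSnd then show ?case by (cases d) auto
next
  case (CPair f g) then show ?case by (cases d) (simp_all, presburger+)
next
  case (CComp f g) then show ?case by (cases d) (simp_all, presburger+)
next
  case (CPrec f g) then show ?case by (cases d) (simp_all, presburger+)
next
  case (CMin f) then show ?case by (cases d) (simp_all, presburger+)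
qed

lemma goedel_surj: "\<exists>c. goedel c = n"
proof (induction n rule: less_induct)
  case (less n)
  show ?case
  proof (cases "n < 4")
    case True
    then consider "n = 0" | "n = 1" | "n = 2" | "n = 3" by linarith
    then show ?thesis by cases (metis goedel.simps(1-4))+
  next
    case False
    define q where "q = (n - 4) div 4"
    obtain a b where ab: "prod_decode q = (a, b)" by fastforce
    then have q: "q = prod_encode (a, b)" by (metis prod_decode_inverse)
    have "q < n" using False by (auto simp: q_def)
    moreover have "a \<le> q" "b \<le> q" by (simp_all add: q le_prod_encode_1 le_prod_encode_2)
    ultimately obtain f g h where fgh: "goedel f = a" "goedel g = b" "goedel h = q"
      using less by (meson order.strict_trans1)
    have "n = 4 + 4 * q \<or> n = 5 + 4 * q \<or> n = 6 + 4 * q \<or> n = 7 + 4 * q"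
      using False unfolding q_def by presburger
    then show ?thesis
      using fgh q by (metis goedel.simps(5-8))
  qed
qed

lemma bij_goedel: "bij goedel"
proof (rule bijI)
  show "inj goedel" by (rule injI) (rule goedel_inj)
  show "surj goedel" unfolding surj_def using goedel_surj by metis
qed

definition phi :: "nat \<Rightarrow> nat \<rightharpoonup> nat" where
  "phi e = eval (inv goedel e)"

definition partial_recursive :: "(nat \<rightharpoonup> nat) \<Rightarrow> bool" where
  "partial_recursive f \<longleftrightarrow> (\<exists>e. phi e = f)"

definition computably_enumerable :: "nat set \<Rightarrow> bool" where
  "computably_enumerable A \<longleftrightarrow> (\<exists>f. partial_recursive f \<and> dom f = A)"

definition initial_segment :: "(nat \<Rightarrow> bool) \<Rightarrow> nat \<Rightarrow> bool list" where
  "initial_segment X n = map X [0..<n]"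

definition cylinder :: "bool list \<Rightarrow> (nat \<Rightarrow> bool) set" where
  "cylinder \<sigma> = {X. initial_segment X (length \<sigma>) = \<sigma>}"

definition string_encode :: "bool list \<Rightarrow> nat" where
  "string_encode \<sigma> = list_encode (map of_bool \<sigma>)"

definition computable_on_strings :: "(bool list \<Rightarrow> nat) \<Rightarrow> bool" where
  "computable_on_strings L \<longleftrightarrow>
     (\<exists>f. partial_recursive f \<and> (\<forall>\<sigma>. f (string_encode \<sigma>) = Some (L \<sigma>)))"

definition cantor_measure :: "(nat \<Rightarrow> bool) measure \<Rightarrow> bool" where
  "cantor_measure \<mu> \<longleftrightarrow> prob_space \<mu> \<and> sets \<mu> = sets borel"

text \<open>
  On input \<open>(\<sigma>, n)\<close> the function outputs the numerator \<open>k\<close> of a dyadic rational \<open>k / 2 ^ n\<close>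
  approximating the measure of the cylinder of \<open>\<sigma>\<close> with error at most \<open>2 ^ - n\<close>.
\<close>

definition computes_measure :: "(nat \<rightharpoonup> nat) \<Rightarrow> (nat \<Rightarrow> bool) measure \<Rightarrow> bool" where
  "computes_measure f \<mu> \<longleftrightarrow> cantor_measure \<mu> \<and>
     (\<forall>\<sigma> n. \<exists>k. f (prod_encode (string_encode \<sigma>, n)) = Some k \<and>
        \<bar>measure \<mu> (cylinder \<sigma>) - real k / 2 ^ n\<bar> \<le> 1 / 2 ^ n)"

definition computable_measure :: "(nat \<Rightarrow> bool) measure \<Rightarrow> bool" where
  "computable_measure \<mu> \<longleftrightarrow> (\<exists>f. partial_recursive f \<and> computes_measure f \<mu>)"

text \<open>
  \<open>mu e\<close> is the measure approximated by the partial recursive function with number \<open>e\<close>; the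
  value \<^const>\<open>None\<close> means that the partial measure with index \<open>e\<close> is not total, which includes
  the case that the approximations are inconsistent with every probability measure.
\<close>

definition mu :: "nat \<Rightarrow> (nat \<Rightarrow> bool) measure option" where
  "mu e = (if \<exists>\<mu>. computes_measure (phi e) \<mu>
           then Some (THE \<mu>. computes_measure (phi e) \<mu>) else None)"

lemma initial_segment_eq_iff:
  "initial_segment X n = initial_segment Y n \<longleftrightarrow> (\<forall>i<n. X i = Y i)"
  by (auto simp: initial_segment_def)

lemma cylinder_initial_segment: "Y \<in> cylinder (initial_segment X n) \<longleftrightarrow> (\<forall>i<n. Y i = X i)"
proof -
  have "length (initial_segment X n) = n" by (simp add: initial_segment_def)
  then show ?thesis by (simp add: cylinder_def initial_segment_eq_iff)
qed

lemma cylinder_altdef: "cylinder \<sigma> = {X. \<forall>i<length \<sigma>. X i = \<sigma> ! i}"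
  unfolding cylinder_def initial_segment_def by (subst list_eq_iff_nth_eq) simp

lemma open_cylinder: "open (cylinder \<sigma>)"
proof -
  have "cylinder \<sigma> = (\<Inter>i\<in>{..<length \<sigma>}. (\<lambda>X. X i) -` {\<sigma> ! i})"
    by (auto simp: cylinder_altdef)
  moreover have "open ((\<lambda>X::nat \<Rightarrow> bool. X i) -` {b})" for i b
    by (rule open_vimage[OF _ continuous_on_product_coordinates]) (rule discrete_topology_class.open_discrete)
  ultimately show ?thesis by (simp only:) (intro open_INT finite_lessThan ballI)
qed

lemma open_contains_cylinder:
  assumes "open U" "X \<in> U"
  shows "\<exists>n. cylinder (initial_segment X n) \<subseteq> U"
proof -
  obtain A where A: "X \<in> Pi\<^sub>E UNIV A" "finite {i. A i \<noteq> UNIV}" "Pi\<^sub>E UNIV A \<subseteq> U"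
    using product_topology_open_contains_basis[of "\<lambda>_. euclidean" UNIV U X] assms
    by (auto simp: open_fun_def)
  obtain n where n: "\<forall>i. A i \<noteq> UNIV \<longrightarrow> i < n"
    using A(2) unfolding finite_nat_set_iff_bounded by blast
  have "cylinder (initial_segment X n) \<subseteq> Pi\<^sub>E UNIV A"
  proof
    fix Y assume "Y \<in> cylinder (initial_segment X n)"
    then have *: "\<forall>i<n. Y i = X i" by (simp add: cylinder_initial_segment)
    have "Y i \<in> A i" for i
      using * n A(1) by (cases "A i = UNIV") (simp_all add: PiE_iff)
    then show "Y \<in> Pi\<^sub>E UNIV A" by (simp add: PiE_iff)
  qed
  then show ?thesis using A(3) by blast
qed

lemma borel_eq_sigma_cylinders:
  "sets (borel :: (nat \<Rightarrow> bool) measure) = sigma_sets UNIV (insert {} (range cylinder))"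
proof -
  let ?E = "insert {} (range cylinder)"
  have "U \<in> sigma_sets UNIV ?E" if "open U" for U
  proof -
    have "U = \<Union> (cylinder ` {\<sigma>. cylinder \<sigma> \<subseteq> U})"
    proof (intro equalityI subsetI)
      fix X assume "X \<in> U"
      then obtain n where "cylinder (initial_segment X n) \<subseteq> U"
        using open_contains_cylinder[OF \<open>open U\<close>] by blast
      moreover have "X \<in> cylinder (initial_segment X n)"
        by (simp add: cylinder_initial_segment)
      ultimately show "X \<in> \<Union> (cylinder ` {\<sigma>. cylinder \<sigma> \<subseteq> U})" by blast
    qed auto
    moreover have "\<Union> (cylinder ` {\<sigma>. cylinder \<sigma> \<subseteq> U}) \<in> sets (sigma UNIV ?E)"
      by (intro sets.countable_UN') auto
    ultimately show ?thesis by simp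
  qed
  then have "sigma_sets UNIV {S. open S} = sigma_sets UNIV ?E"
    by (intro sigma_sets_eqI) (auto intro: open_cylinder sigma_sets.Basic sigma_sets.Empty)
  then show ?thesis by (simp add: borel_def)
qed

lemma Int_stable_cylinders: "Int_stable (insert {} (range cylinder))"
proof (rule Int_stableI)
  have *: "cylinder \<sigma> \<inter> cylinder \<tau> \<in> insert {} (range cylinder)"
    if "length \<sigma> \<le> length \<tau>" for \<sigma> \<tau>
  proof (cases "\<forall>i<length \<sigma>. \<sigma> ! i = \<tau> ! i")
    case True
    then have "cylinder \<tau> \<subseteq> cylinder \<sigma>"
      using that by (simp add: cylinder_altdef subset_iff)
    then have "cylinder \<sigma> \<inter> cylinder \<tau> = cylinder \<tau>" by blast
    then show ?thesis by simp
  next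
    case False
    then obtain i where i: "i < length \<sigma>" "\<sigma> ! i \<noteq> \<tau> ! i" by blast
    then have "X \<notin> cylinder \<tau>" if "X \<in> cylinder \<sigma>" for X
      using that \<open>length \<sigma> \<le> length \<tau>\<close> unfolding cylinder_altdef
      by (metis (mono_tags, lifting) mem_Collect_eq order_less_le_trans)
    then have "cylinder \<sigma> \<inter> cylinder \<tau> = {}" by blast
    then show ?thesis by simp
  qed
  fix a b assume "a \<in> insert {} (range cylinder)" "b \<in> insert {} (range cylinder)"
  then consider "a = {} \<or> b = {}" | \<sigma> \<tau> where "a = cylinder \<sigma>" "b = cylinder \<tau>" by blast
  then show "a \<inter> b \<in> insert {} (range cylinder)"
  proof cases
    case (2 \<sigma> \<tau>)
    then show ?thesis
      using *[of \<sigma> \<tau>] *[of \<tau> \<sigma>] by (cases "length \<sigma> \<le> length \<tau>") (simp_all add: Int_commute)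
  qed auto
qed

lemma computes_measure_unique:
  assumes "computes_measure f \<mu>" "computes_measure f \<nu>"
  shows "\<mu> = \<nu>"
proof -
  have prob: "prob_space \<mu>" "prob_space \<nu>" and sets: "sets \<mu> = sets borel" "sets \<nu> = sets borel"
    using assms unfolding computes_measure_def cantor_measure_def by blast+
  interpret M: prob_space \<mu> by (rule prob(1))
  interpret N: prob_space \<nu> by (rule prob(2))
  have cyl: "measure \<mu> (cylinder \<sigma>) = measure \<nu> (cylinder \<sigma>)" for \<sigma>
  proof -
    let ?d = "\<bar>measure \<mu> (cylinder \<sigma>) - measure \<nu> (cylinder \<sigma>)\<bar>"
    have "?d \<le> 2 * (1 / 2) ^ n" for n
    proof -
      let ?x = "f (prod_encode (string_encode \<sigma>, n))"
      obtain k where "?x = Some k"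
        and k: "\<bar>measure \<mu> (cylinder \<sigma>) - real k / 2 ^ n\<bar> \<le> 1 / 2 ^ n"
        using assms(1) unfolding computes_measure_def by blast
      moreover obtain k' where "?x = Some k'"
        and k': "\<bar>measure \<nu> (cylinder \<sigma>) - real k' / 2 ^ n\<bar> \<le> 1 / 2 ^ n"
        using assms(2) unfolding computes_measure_def by blast
      ultimately have "?d \<le> 1 / 2 ^ n + 1 / 2 ^ n" by auto
      then show ?thesis by (simp add: power_one_over)
    qed
    moreover have "(\<lambda>n. 2 * (1 / 2) ^ n :: real) \<longlonglongrightarrow> 2 * 0"
      by (intro tendsto_intros LIMSEQ_realpow_zero) auto
    ultimately have "?d \<le> 2 * 0"
      by (intro LIMSEQ_le_const) blast+
    then show ?thesis by simp
  qed
  show ?thesis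
  proof (rule measure_eqI_generator_eq[OF Int_stable_cylinders, of UNIV _ _ "\<lambda>_. cylinder []"])
    fix A assume "A \<in> insert {} (range cylinder)"
    then show "emeasure \<mu> A = emeasure \<nu> A"
      using cyl by (auto simp: M.emeasure_eq_measure N.emeasure_eq_measure)
  next
    show "range (\<lambda>_::nat. cylinder []) \<subseteq> insert {} (range cylinder)" by blast
    show "(\<Union>i::nat. cylinder []) = UNIV" by (simp add: cylinder_altdef)
  qed (simp_all add: sets borel_eq_sigma_cylinders)
qed

lemma mu_eq_Some_iff: "mu e = Some \<mu> \<longleftrightarrow> computes_measure (phi e) \<mu>"
proof
  assume "mu e = Some \<mu>"
  then obtain \<nu> where \<nu>: "computes_measure (phi e) \<nu>" and "\<mu> = (THE \<mu>. computes_measure (phi e) \<mu>)"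
    by (auto simp: mu_def split: if_splits)
  moreover have "(THE \<mu>. computes_measure (phi e) \<mu>) = \<nu>"
    by (rule the_equality[where P = "computes_measure (phi e)", OF \<nu>])
      (rule computes_measure_unique[OF _ \<nu>])
  ultimately show "computes_measure (phi e) \<mu>" by simp
next
  assume \<mu>: "computes_measure (phi e) \<mu>"
  have "(THE \<mu>. computes_measure (phi e) \<mu>) = \<mu>"
    by (rule the_equality[where P = "computes_measure (phi e)", OF \<mu>])
      (rule computes_measure_unique[OF _ \<mu>])
  then show "mu e = Some \<mu>" using \<mu> by (auto simp: mu_def)
qed

lemma computable_measure_iff_index: "computable_measure \<mu> \<longleftrightarrow> (\<exists>e. mu e = Some \<mu>)"
  by (auto simp: mu_eq_Some_iff computable_measure_def partial_recursive_def)

definition open_of :: "bool list set \<Rightarrow> (nat \<Rightarrow> bool) set" where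
  "open_of S = (\<Union>\<sigma>\<in>S. cylinder \<sigma>)"

definition ml_test :: "(nat \<Rightarrow> bool) measure \<Rightarrow> (nat \<Rightarrow> bool list set) \<Rightarrow> bool" where
  "ml_test \<mu> W \<longleftrightarrow>
     computably_enumerable {prod_encode (m, string_encode \<sigma>) | m \<sigma>. \<sigma> \<in> W m} \<and>
     (\<forall>m. measure \<mu> (open_of (W m)) \<le> 1 / 2 ^ m)"

definition ml_random :: "(nat \<Rightarrow> bool) measure \<Rightarrow> (nat \<Rightarrow> bool) \<Rightarrow> bool" where
  "ml_random \<mu> X \<longleftrightarrow> (\<forall>W. ml_test \<mu> W \<longrightarrow> X \<notin> (\<Inter>m. open_of (W m)))"

definition partially_succeeds :: "(bool list \<Rightarrow> nat) \<Rightarrow> (nat \<Rightarrow> bool) measure \<Rightarrow> bool" where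
  "partially_succeeds L \<mu> \<longleftrightarrow>
     (\<forall>X. ml_random \<mu> X \<longrightarrow>
       (\<exists>j\<^sub>0. infinite {n. L (initial_segment X n) = j\<^sub>0} \<and>
             (\<forall>j. j \<noteq> j\<^sub>0 \<longrightarrow> finite {n. L (initial_segment X n) = j}) \<and>
             (\<exists>\<nu>. mu j\<^sub>0 = Some \<nu> \<and> ml_random \<nu> X)))"

end

theory Submission
  imports Defs
begin

text \<open>
  For an index \<open>e\<close> and a constant \<open>c\<close>, the statement that \<open>e\<close> computes a measure and that \<open>X\<close> avoids
  the \<open>c\<close>-th level of a universal Martin-Loef test for that measure is \<open>\<Pi>\<^sub>2\<close> in \<open>X\<close>, uniformly in
  \<open>(e, c)\<close>. Hence there is a computable notion of a pair being active at a stage, depending on an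
  initial segment of \<open>X\<close> only, such that \<open>(e, c)\<close> is active infinitely often if and only if the
  statement holds. At a stage where \<open>i = (e, c)\<close> is active, the learner outputs an index equivalent to
  \<open>e\<close> that is padded with \<open>i\<close> and with the number of earlier activities of smaller pairs. That number
  is eventually constant for the least pair that is active infinitely often and unbounded for all larger
  ones, so exactly one value is output infinitely often.
\<close>

section \<open>Closure properties of total recursive functions\<close>

text \<open>The forall-exists form is due to the totality of \<open>phi e\<close> alone; that its
  values fit a measure and that \<open>X\<close> avoids the test are universal conditions. For the
  former, inconsistencies between approximations can be enumerated, and a total family free of them
  comes from a measure, built from Lebesgue measure. For the latter, the obstacle is that no
  algorithm tells whether an enumerated family of open sets obeys the measure bounds of a test. The
  universal test therefore takes from every enumeration just those stages whose measure, as
  estimated from \<open>phi e\<close>, looks small. It is defined for every \<open>e\<close>, but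
  its bounds are claimed only when \<open>e\<close> computes a measure. The existential quantifier
  in "some level is avoided" moves into the pair that the learner tries. As \<open>eval\<close> has
  no notion of running time, running a program for a bounded time needs a separate stagewise
  enumeration of its values, which must itself be shown recursive.\<close>

abbreviation pfst :: "nat \<Rightarrow> nat" where "pfst x \<equiv> fst (prod_decode x)"
abbreviation psnd :: "nat \<Rightarrow> nat" where "psnd x \<equiv> snd (prod_decode x)"

definition total_recursive :: "(nat \<Rightarrow> nat) \<Rightarrow> bool" where
  "total_recursive f \<longleftrightarrow> (\<exists>c. \<forall>x. eval c x = Some (f x))"

definition decidable :: "(nat \<Rightarrow> bool) \<Rightarrow> bool" where
  "decidable P \<longleftrightarrow> total_recursive (\<lambda>x. of_bool (P x))"

lemma tr_const: "total_recursive (\<lambda>x. n)"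
proof (induction n)
  case 0
  have "\<forall>x. eval CZero x = Some 0" by simp
  then show ?case unfolding total_recursive_def by blast
next
  case (Suc n)
  then obtain c where "\<forall>x. eval c x = Some n" unfolding total_recursive_def by blast
  then have "\<forall>x. eval (CComp CSucc c) x = Some (Suc n)" by simp
  then show ?case unfolding total_recursive_def by blast
qed

lemma eval_id: "eval (CPair CFst CSnd) x = Some x"
  by simp

lemma tr_id: "total_recursive (\<lambda>x. x)"
  unfolding total_recursive_def using eval_id by blast

lemma tr_comp:
  assumes "total_recursive f" "total_recursive a"
  shows "total_recursive (\<lambda>x. f (a x))"
proof -
  from assms obtain c d where "\<forall>x. eval c x = Some (f x)" "\<forall>x. eval d x = Some (a x)"
    unfolding total_recursive_def by blast
  then have "\<forall>x. eval (CComp c d) x = Some (f (a x))" by simp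
  then show ?thesis unfolding total_recursive_def by blast
qed

lemma tr_Suc: "total_recursive a \<Longrightarrow> total_recursive (\<lambda>x. Suc (a x))"
  by (erule tr_comp[of Suc, rotated]) (unfold total_recursive_def, rule exI[of _ CSucc], simp)

lemma tr_pfst: "total_recursive a \<Longrightarrow> total_recursive (\<lambda>x. pfst (a x))"
  by (erule tr_comp[of pfst, rotated]) (unfold total_recursive_def, rule exI[of _ CFst], simp)

lemma tr_psnd: "total_recursive a \<Longrightarrow> total_recursive (\<lambda>x. psnd (a x))"
  by (erule tr_comp[of psnd, rotated]) (unfold total_recursive_def, rule exI[of _ CSnd], simp)

lemma tr_pair:
  assumes "total_recursive a" "total_recursive b"
  shows "total_recursive (\<lambda>x. prod_encode (a x, b x))"
proof -
  from assms obtain c d where "\<forall>x. eval c x = Some (a x)" "\<forall>x. eval d x = Some (b x)"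
    unfolding total_recursive_def by blast
  then have "\<forall>x. eval (CPair c d) x = Some (prod_encode (a x, b x))" by simp
  then show ?thesis unfolding total_recursive_def by blast
qed

text \<open>The parameter passed to \<open>CPrec\<close> is the whole input \<open>x\<close>, so the
  start value, the step and the number of rounds may all depend on it.\<close>

lemma tr_rec_nat:
  assumes "total_recursive a" "total_recursive n"
    "total_recursive (\<lambda>z. g (pfst z) (pfst (psnd z)) (psnd (psnd z)))"
  shows "total_recursive (\<lambda>x. rec_nat (a x) (\<lambda>m v. g x m v) (n x))"
proof -
  from assms obtain c d e where c: "\<And>x. eval c x = Some (a x)" and d: "\<And>x. eval d x = Some (n x)"
    and e: "\<And>z. eval e z = Some (g (pfst z) (pfst (psnd z)) (psnd (psnd z)))"
    unfolding total_recursive_def by blast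
  have *: "rec_nat (eval c x) (\<lambda>m r. Option.bind r (\<lambda>v. eval e (prod_encode (x, prod_encode (m, v))))) k
    = Some (rec_nat (a x) (\<lambda>m v. g x m v) k)" for x k
    by (induction k) (simp_all add: c e)
  have "eval (CComp (CPrec c e) (CPair (CPair CFst CSnd) d)) x
    = Some (rec_nat (a x) (\<lambda>m v. g x m v) (n x))" for x
    by (simp add: d *)
  then show ?thesis unfolding total_recursive_def by blast
qed

lemma tr_add:
  assumes "total_recursive a" "total_recursive b"
  shows "total_recursive (\<lambda>x. a x + b x)"
proof -
  have "rec_nat v (\<lambda>m v. Suc v) u = u + v" for u v by (induction u) auto
  moreover have "total_recursive (\<lambda>x. rec_nat (b x) (\<lambda>m v. Suc v) (a x))"
    by (intro tr_rec_nat tr_Suc tr_psnd tr_id assms)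
  ultimately show ?thesis by simp
qed

lemma tr_diff:
  assumes "total_recursive a" "total_recursive b"
  shows "total_recursive (\<lambda>x. a x - b x)"
proof -
  have "rec_nat 0 (\<lambda>m v. m) u = u - 1" for u :: nat by (induction u) auto
  moreover have "total_recursive (\<lambda>x. rec_nat 0 (\<lambda>m v. m) x)"
    by (intro tr_rec_nat tr_const tr_psnd tr_pfst tr_id)
  ultimately have pred: "total_recursive (\<lambda>x. x - 1)" by simp
  have "total_recursive (\<lambda>x. rec_nat (a x) (\<lambda>m v. v - 1) (b x))"
    by (intro tr_rec_nat tr_comp[OF pred] tr_psnd tr_id assms)
  moreover have "rec_nat u (\<lambda>m v. v - 1) v = u - v" for u v :: nat by (induction v) auto
  ultimately show ?thesis by simp
qed

lemma tr_mult:
  assumes "total_recursive a" "total_recursive b"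
  shows "total_recursive (\<lambda>x. a x * b x)"
proof -
  have "rec_nat 0 (\<lambda>m w. w + v) u = u * v" for u v :: nat by (induction u) auto
  moreover have "total_recursive (\<lambda>x. rec_nat 0 (\<lambda>m w. w + b x) (a x))"
    by (intro tr_rec_nat tr_add tr_const tr_psnd tr_id assms tr_comp[OF assms(2)] tr_pfst)
  ultimately show ?thesis by simp
qed

lemma tr_power:
  assumes "total_recursive a" "total_recursive b"
  shows "total_recursive (\<lambda>x. a x ^ b x)"
proof -
  have "rec_nat 1 (\<lambda>m w. w * v) u = v ^ u" for u v :: nat by (induction u) auto
  moreover have "total_recursive (\<lambda>x. rec_nat 1 (\<lambda>m w. w * a x) (b x))"
    by (intro tr_rec_nat tr_mult tr_const tr_psnd tr_id assms tr_comp[OF assms(1)] tr_pfst)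
  ultimately show ?thesis by simp
qed

lemma tr_sum:
  assumes "total_recursive b" "total_recursive (\<lambda>z. f (pfst z) (psnd z))"
  shows "total_recursive (\<lambda>x. \<Sum>k<b x. f x k)"
proof -
  have *: "total_recursive (\<lambda>z. f (pfst z) (pfst (psnd z)))"
    using tr_comp[OF assms(2), of "\<lambda>z. prod_encode (pfst z, pfst (psnd z))"]
    by (simp add: tr_pair tr_pfst tr_psnd tr_id)
  have "total_recursive (\<lambda>x. rec_nat 0 (\<lambda>m w. w + f x m) (b x))"
    by (intro tr_rec_nat tr_add tr_const tr_psnd tr_id assms *)
  moreover have "rec_nat 0 (\<lambda>m w. w + f x m) u = (\<Sum>k<u. f x k)" for x u
    by (induction u) auto
  ultimately show ?thesis by simp
qed

lemma tr_of_bool: "decidable P \<Longrightarrow> total_recursive (\<lambda>x. of_bool (P x))"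
  by (simp add: decidable_def)

lemma dec_not:
  assumes "decidable P"
  shows "decidable (\<lambda>x. \<not> P x)"
proof -
  have "of_bool (\<not> p) = 1 - (of_bool p :: nat)" for p by (cases p) simp_all
  then show ?thesis
    using assms unfolding decidable_def by (simp only:) (intro tr_diff tr_const)
qed

lemma dec_conj: "decidable P \<Longrightarrow> decidable Q \<Longrightarrow> decidable (\<lambda>x. P x \<and> Q x)"
  unfolding decidable_def of_bool_conj by (rule tr_mult)

lemma dec_disj: "decidable P \<Longrightarrow> decidable Q \<Longrightarrow> decidable (\<lambda>x. P x \<or> Q x)"
  by (subst (1) not_not[symmetric], unfold de_Morgan_disj) (intro dec_not dec_conj)

lemma dec_imp: "decidable P \<Longrightarrow> decidable Q \<Longrightarrow> decidable (\<lambda>x. P x \<longrightarrow> Q x)"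
  unfolding imp_conv_disj by (intro dec_disj dec_not)

lemma dec_le:
  assumes "total_recursive a" "total_recursive b"
  shows "decidable (\<lambda>x. a x \<le> b x)"
proof -
  have "of_bool (u \<le> v) = 1 - (u - v)" for u v :: nat by auto
  then show ?thesis
    unfolding decidable_def by (simp only:) (intro tr_diff tr_const assms)
qed

lemma dec_less:
  assumes "total_recursive a" "total_recursive b"
  shows "decidable (\<lambda>x. a x < b x)"
  using dec_le[OF tr_Suc[OF assms(1)] assms(2)] by (simp add: Suc_le_eq)

lemma dec_eq:
  assumes "total_recursive a" "total_recursive b"
  shows "decidable (\<lambda>x. a x = b x)"
  using dec_conj[OF dec_le[OF assms] dec_le[OF assms(2,1)]] by (simp add: eq_iff)

lemma tr_if:
  assumes "decidable P" "total_recursive a" "total_recursive b"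
  shows "total_recursive (\<lambda>x. if P x then a x else b x)"
proof -
  have "(if p then u else v) = of_bool p * u + of_bool (\<not> p) * v" for p and u v :: nat by simp
  then show ?thesis
    by (simp only:) (intro tr_add tr_mult tr_of_bool dec_not assms)
qed

text \<open>A bounded existential quantifier is the positivity of a bounded sum of
  indicators.\<close>

lemma dec_ex_less:
  assumes "total_recursive b" "decidable (\<lambda>z. P (pfst z) (psnd z))"
  shows "decidable (\<lambda>x. \<exists>k<b x. P x k)"
proof -
  have "(\<exists>k<u. P x k) \<longleftrightarrow> 0 < (\<Sum>k<u. of_bool (P x k) :: nat)" for u x
    by (induction u) (auto simp: less_Suc_eq)
  moreover have "decidable (\<lambda>x. 0 < (\<Sum>k<b x. of_bool (P x k) :: nat))"
    by (intro dec_less tr_const tr_sum assms tr_of_bool)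
  ultimately show ?thesis by simp
qed

lemma dec_all_less:
  assumes "total_recursive b" "decidable (\<lambda>z. P (pfst z) (psnd z))"
  shows "decidable (\<lambda>x. \<forall>k<b x. P x k)"
  using dec_not[OF dec_ex_less[OF assms(1) dec_not[OF assms(2)]]] by simp

text \<open>Syntax-directed rules: one \<open>intro\<close> handles anything built from arithmetic,
  primitive recursion, bounded sums and bounded quantifiers. This is why the later predicates bound
  all their quantifiers.\<close>

lemmas recursive_intros = tr_const tr_id tr_Suc tr_pfst tr_psnd tr_pair tr_rec_nat tr_add tr_diff
  tr_mult tr_power tr_sum tr_of_bool tr_if dec_not dec_conj dec_disj dec_imp dec_le dec_less dec_eq
  dec_ex_less dec_all_less

text \<open>Division is not among the closure rules; this expresses a binary digit by products,
  powers and bounded quantifiers.\<close>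

lemma odd_div_power_iff:
  "odd (d div 2 ^ k) \<longleftrightarrow> (\<exists>q<Suc d. \<exists>r<2 ^ k. d = (2 * q + 1) * 2 ^ k + r)" for d :: nat
proof
  assume "odd (d div 2 ^ k)"
  then obtain q where q: "d div 2 ^ k = 2 * q + 1" by (auto elim: oddE)
  have "d = (2 * q + 1) * 2 ^ k + d mod 2 ^ k" using div_mult_mod_eq[of d "2 ^ k"] by (simp add: q)
  moreover have "q < Suc d" using q div_le_dividend[of d "2 ^ k"] by linarith
  ultimately show "\<exists>q<Suc d. \<exists>r<2 ^ k. d = (2 * q + 1) * 2 ^ k + r"
    by (intro exI[of _ q] conjI exI[of _ "d mod 2 ^ k"]) auto
next
  assume "\<exists>q<Suc d. \<exists>r<2 ^ k. d = (2 * q + 1) * 2 ^ k + r"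
  then obtain q r where "r < 2 ^ k" "d = (2 * q + 1) * 2 ^ k + r" by blast
  then have "d div 2 ^ k = 2 * q + 1" by (simp add: div_nat_eqI)
  then show "odd (d div 2 ^ k)" by simp
qed

lemma dec_set_decode:
  assumes "total_recursive a" "total_recursive b"
  shows "decidable (\<lambda>x. a x \<in> set_decode (b x))"
proof -
  have "decidable (\<lambda>z. \<exists>q<Suc (psnd z). \<exists>r<2 ^ pfst z. psnd z = (2 * q + 1) * 2 ^ pfst z + r)"
    by (intro recursive_intros)
  then have "total_recursive (\<lambda>z. of_bool (pfst z \<in> set_decode (psnd z)))"
    unfolding odd_div_power_iff[symmetric] decidable_def set_decode_def mem_Collect_eq .
  from tr_comp[OF this tr_pair[OF assms]] show ?thesis by (simp add: decidable_def)
qed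

text \<open>\<open>CMin\<close> looks for a zero, so it is applied to the indicator of the negation.
  That indicator is total, hence the condition on the values before the zero only says that no
  earlier witness exists.\<close>

lemma search_code:
  assumes "decidable (\<lambda>z. R (pfst z) (psnd z))"
  shows "\<exists>c. \<forall>x. eval c x = (if \<exists>w. R x w then Some (LEAST w. R x w) else None)"
proof -
  obtain c where c: "\<And>z. eval c z = Some (of_bool (\<not> R (pfst z) (psnd z)))"
    using dec_not[OF assms] unfolding decidable_def total_recursive_def by blast
  have "of_bool (\<not> p) = (0::nat) \<longleftrightarrow> p" "(\<exists>y. of_bool (\<not> p) = Suc y) \<longleftrightarrow> \<not> p" for p
    by (cases p; simp)+
  then have "eval (CMin c) x = (if \<exists>n. R x n \<and> (\<forall>m<n. \<not> R x m) then Some (LEAST w. R x w) else None)" for x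
    by (simp add: c)
  then have "\<forall>x. eval (CMin c) x = (if \<exists>w. R x w then Some (LEAST w. R x w) else None)"
    by (subst (asm) exists_least_iff[symmetric]) blast
  then show ?thesis by blast
qed

lemma partial_recursive_eval: "partial_recursive (eval c)"
  unfolding partial_recursive_def phi_def
  by (intro exI[of _ "goedel c"]) (simp add: bij_goedel bij_is_inj)

lemma ce_projection:
  assumes "decidable (\<lambda>z. R (pfst z) (psnd z))"
  shows "computably_enumerable {x. \<exists>w. R x w}"
proof -
  obtain c where "\<forall>x. eval c x = (if \<exists>w. R x w then Some (LEAST w. R x w) else None)"
    using search_code[OF assms] by blast
  then have "dom (eval c) = {x. \<exists>w. R x w}" by (auto simp: dom_def)
  then show ?thesis
    unfolding computably_enumerable_def using partial_recursive_eval by blast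
qed


section \<open>A stagewise enumeration of the graph of a universal function\<close>

lemma dec_comp: "decidable P \<Longrightarrow> total_recursive a \<Longrightarrow> decidable (\<lambda>x. P (a x))"
  unfolding decidable_def by (rule tr_comp)

abbreviation fact_code :: "nat \<Rightarrow> nat \<Rightarrow> nat \<Rightarrow> nat" where
  "fact_code c x y \<equiv> prod_encode (c, prod_encode (x, y))"

text \<open>
  Here \<open>S\<close> is a set of already known facts \<open>fact_code c x y\<close>, meaning that program \<open>c\<close> on input \<open>x\<close>
  has output \<open>y\<close>; the numbers \<open>4 + 4 * q\<close> to \<open>7 + 4 * q\<close> are those of \<^const>\<open>goedel\<close>.
\<close>

definition derivable_from :: "nat set \<Rightarrow> nat \<Rightarrow> nat \<Rightarrow> nat \<Rightarrow> bool" where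
  "derivable_from S c x y \<longleftrightarrow>
     c = 0 \<and> y = 0 \<or> c = 1 \<and> y = Suc x \<or> c = 2 \<and> y = pfst x \<or> c = 3 \<and> y = psnd x \<or>
     (\<exists>q<c. c = 4 + 4 * q \<and> fact_code (pfst q) x (pfst y) \<in> S \<and> fact_code (psnd q) x (psnd y) \<in> S) \<or>
     (\<exists>q<c. c = 5 + 4 * q \<and> (\<exists>a. fact_code (psnd q) x a \<in> S \<and> fact_code (pfst q) a y \<in> S)) \<or>
     (\<exists>q<c. c = 6 + 4 * q \<and> psnd x = 0 \<and> fact_code (pfst q) (pfst x) y \<in> S) \<or>
     (\<exists>q<c. c = 6 + 4 * q \<and> (\<exists>m<psnd x. psnd x = Suc m \<and>
        (\<exists>v. fact_code c (prod_encode (pfst x, m)) v \<in> S \<and>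
             fact_code (psnd q) (prod_encode (pfst x, prod_encode (m, v))) y \<in> S))) \<or>
     (\<exists>q<c. c = 7 + 4 * q \<and> fact_code q (prod_encode (x, y)) 0 \<in> S \<and>
        (\<forall>m<y. \<exists>z. fact_code q (prod_encode (x, m)) (Suc z) \<in> S))"

text \<open>One round of derivation per stage. The cut-off \<open>k < Suc s\<close> keeps every
  stage finite, hence codable as one number, and puts all values known at stage \<open>s\<close>
  below \<open>s\<close>.\<close>

primrec facts :: "nat \<Rightarrow> nat set" where
  "facts 0 = {}"
| "facts (Suc s) = {k. k < Suc s \<and> derivable_from (facts s) (pfst k) (pfst (psnd k)) (psnd (psnd k))}"

definition computed_by :: "nat \<Rightarrow> nat \<Rightarrow> nat \<Rightarrow> nat \<Rightarrow> bool" where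
  "computed_by s e x y \<longleftrightarrow> fact_code e x y \<in> facts s"

lemma facts_bound: "k \<in> facts s \<Longrightarrow> k < s"
  by (cases s) auto

lemma computed_by_bound: "computed_by s e x y \<Longrightarrow> y < s"
  unfolding computed_by_def
  using facts_bound[of "fact_code e x y" s] le_prod_encode_2[of "prod_encode (x, y)" e]
    le_prod_encode_2[of y x] by linarith

text \<open>\<open>S\<close> occurs only positively: nonzero values before a zero are witnessed by
  facts with output \<open>Suc z\<close>, not by the absence of a fact.\<close>

lemma derivable_from_mono: "S \<subseteq> T \<Longrightarrow> derivable_from S c x y \<Longrightarrow> derivable_from T c x y"
  unfolding derivable_from_def by (elim disj_forward; blast)

lemma facts_Suc_mono: "facts s \<subseteq> facts (Suc s)"
proof (induction s)
  case (Suc s)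
  show ?case
  proof
    fix k assume k: "k \<in> facts (Suc s)"
    then have "derivable_from (facts (Suc s)) (pfst k) (pfst (psnd k)) (psnd (psnd k))"
      using derivable_from_mono[OF Suc.IH] by simp
    moreover have "k < Suc (Suc s)" using facts_bound[OF k] by simp
    ultimately show "k \<in> facts (Suc (Suc s))" by simp
  qed
qed simp

lemma facts_mono: "s \<le> t \<Longrightarrow> facts s \<subseteq> facts t"
  by (rule lift_Suc_mono_le[of facts]) (rule facts_Suc_mono)

lemma computed_by_mono: "computed_by s e x y \<Longrightarrow> s \<le> t \<Longrightarrow> computed_by t e x y"
  unfolding computed_by_def using facts_mono by blast

lemma inv_goedel [simp]: "inv goedel (goedel c) = c"
  by (simp add: bij_goedel bij_is_inj)

lemma goedel_inv [simp]: "goedel (inv goedel e) = e"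
  by (simp add: bij_goedel bij_is_surj surj_f_inv_f)

lemma inv_goedel_numbers:
  "inv goedel 0 = CZero" "inv goedel (Suc 0) = CSucc" "inv goedel 2 = CFst" "inv goedel 3 = CSnd"
  "inv goedel (4 + 4 * q) = CPair (inv goedel (pfst q)) (inv goedel (psnd q))"
  "inv goedel (5 + 4 * q) = CComp (inv goedel (pfst q)) (inv goedel (psnd q))"
  "inv goedel (6 + 4 * q) = CPrec (inv goedel (pfst q)) (inv goedel (psnd q))"
  "inv goedel (7 + 4 * q) = CMin (inv goedel q)"
  by (rule inv_f_eq[OF bij_is_inj[OF bij_goedel]], simp)+

lemma phi_CPair:
  "phi (4 + 4 * q) x = Option.bind (phi (pfst q) x) (\<lambda>a. Option.bind (phi (psnd q) x)
     (\<lambda>b. Some (prod_encode (a, b))))"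
  unfolding phi_def inv_goedel_numbers eval.simps by simp

lemma phi_CComp: "phi (5 + 4 * q) x = Option.bind (phi (psnd q) x) (phi (pfst q))"
  unfolding phi_def inv_goedel_numbers eval.simps by simp

lemma phi_CPrec_0: "phi (6 + 4 * q) (prod_encode (a, 0)) = phi (pfst q) a"
  unfolding phi_def inv_goedel_numbers eval.simps by simp

lemma phi_CPrec_Suc:
  "phi (6 + 4 * q) (prod_encode (a, Suc m)) = Option.bind (phi (6 + 4 * q) (prod_encode (a, m)))
     (\<lambda>v. phi (psnd q) (prod_encode (a, prod_encode (m, v))))"
  unfolding phi_def inv_goedel_numbers eval.simps by simp

text \<open>Trades the \<open>LEAST\<close> in \<open>eval\<close> for a condition on the candidate
  \<open>y\<close>, which is the form of the last clause of \<open>derivable_from\<close>.\<close>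

lemma phi_CMin_iff:
  "phi (7 + 4 * q) x = Some y \<longleftrightarrow> phi q (prod_encode (x, y)) = Some 0 \<and>
     (\<forall>m<y. \<exists>z. phi q (prod_encode (x, m)) = Some (Suc z))"
proof -
  let ?Z = "\<lambda>n. phi q (prod_encode (x, n)) = Some 0"
  let ?P = "\<lambda>n. ?Z n \<and> (\<forall>m<n. \<exists>z. phi q (prod_encode (x, m)) = Some (Suc z))"
  have eq: "phi (7 + 4 * q) x = (if \<exists>n. ?P n then Some (LEAST n. ?Z n) else None)"
    unfolding phi_def inv_goedel_numbers eval.simps by (rule refl)
  have least: "(LEAST n. ?Z n) = n" if "?P n" for n
  proof (rule Least_equality)
    show "?Z n" using that by simp
    show "n \<le> k" if "?Z k" for k
    proof (rule ccontr)
      assume "\<not> n \<le> k"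
      then have "k < n" by simp
      then obtain z where "phi q (prod_encode (x, k)) = Some (Suc z)" using \<open>?P n\<close> by blast
      then show False using \<open>?Z k\<close> by simp
    qed
  qed
  show ?thesis
  proof (cases "\<exists>n. ?P n")
    case True
    then obtain n where n: "?P n" by (rule exE)
    have "phi (7 + 4 * q) x = Some (LEAST n. ?Z n)" unfolding eq by (rule if_P[OF True])
    then have "phi (7 + 4 * q) x = Some n" using least[OF n] by (simp only:)
    moreover have "?P y \<longleftrightarrow> y = n"
    proof
      assume "?P y"
      from least[OF this] least[OF n] show "y = n" by (rule trans[OF sym])
    next
      assume "y = n"
      then show "?P y" using n by blast
    qed
    ultimately show ?thesis by (simp only: option.inject) (rule eq_commute)
  next
    case False
    have "phi (7 + 4 * q) x = None" unfolding eq by (rule if_not_P[OF False])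
    then show ?thesis using False by simp
  qed
qed

lemma phi_basic: "phi 0 x = Some 0" "phi (Suc 0) x = Some (Suc x)" "phi 2 x = Some (pfst x)"
  "phi 3 x = Some (psnd x)"
  by (simp_all only: phi_def inv_goedel_numbers eval.simps)

lemma prod_encode_collapse: "x = prod_encode (pfst x, psnd x)"
  by simp

lemma derivable_from_sound:
  assumes S: "\<And>c x y. fact_code c x y \<in> S \<Longrightarrow> phi c x = Some y"
    and "derivable_from S c x y"
  shows "phi c x = Some y"
  using assms(2) unfolding derivable_from_def
proof (elim disjE exE conjE)
  fix q assume "c = 4 + 4 * q" "fact_code (pfst q) x (pfst y) \<in> S" "fact_code (psnd q) x (psnd y) \<in> S"
  then show ?thesis using S by (simp add: phi_CPair)
next
  fix q a assume "c = 5 + 4 * q" "fact_code (psnd q) x a \<in> S" "fact_code (pfst q) a y \<in> S"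
  then show ?thesis using S by (simp add: phi_CComp)
next
  fix q assume "c = 6 + 4 * q" "psnd x = 0" "fact_code (pfst q) (pfst x) y \<in> S"
  then show ?thesis using S phi_CPrec_0[of q "pfst x"] prod_encode_collapse[of x] by simp
next
  fix q m v
  assume c: "c = 6 + 4 * q" and x: "psnd x = Suc m" and S': "fact_code c (prod_encode (pfst x, m)) v \<in> S"
    "fact_code (psnd q) (prod_encode (pfst x, prod_encode (m, v))) y \<in> S"
  have "x = prod_encode (pfst x, Suc m)" using prod_encode_collapse[of x] x by simp
  then show ?thesis
    using S[OF S'(1)] S[OF S'(2)] phi_CPrec_Suc[of q "pfst x" m] by (simp add: c)
next
  fix q assume "c = 7 + 4 * q" "fact_code q (prod_encode (x, y)) 0 \<in> S"
    "\<forall>m<y. \<exists>z. fact_code q (prod_encode (x, m)) (Suc z) \<in> S"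
  then show ?thesis using S by (simp only: phi_CMin_iff) blast
qed (simp_all add: phi_basic)

lemma computed_by_sound:
  assumes "computed_by s e x y"
  shows "phi e x = Some y"
proof -
  have "fact_code e x y \<in> facts s \<Longrightarrow> phi e x = Some y" for e x y
  proof (induction s arbitrary: e x y)
    case (Suc s)
    then show ?case using derivable_from_sound[OF Suc.IH] by simp
  qed simp
  then show ?thesis using assms by (simp add: computed_by_def)
qed

text \<open>By monotonicity. The filter form lets finitely many halting times be combined without
  naming their maximum.\<close>

lemma eventually_computed_by_iff:
  "(\<forall>\<^sub>F s in sequentially. computed_by s e x y) \<longleftrightarrow> (\<exists>s. computed_by s e x y)"
  unfolding eventually_sequentially using computed_by_mono by blast

text \<open>A derivable fact is present one stage later, as soon as the stage exceeds its
  code.\<close>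

lemma eventually_computedI:
  assumes "\<forall>\<^sub>F s in sequentially. derivable_from (facts s) c x y"
  shows "\<forall>\<^sub>F s in sequentially. computed_by s c x y"
proof -
  have "\<forall>\<^sub>F s in sequentially. computed_by (Suc s) c x y"
    using assms eventually_ge_at_top[of "fact_code c x y"]
    by eventually_elim (simp add: computed_by_def)
  then show ?thesis by (rule eventually_sequentially_Suc[THEN iffD1])
qed

text \<open>This and the next four are introduction rules for the clauses on compound programs; the
  bound \<open>q < c\<close> follows from the form of \<open>c\<close>.\<close>

lemma derivable_from_CPair:
  assumes "c = 4 + 4 * q" "fact_code (pfst q) x (pfst y) \<in> S" "fact_code (psnd q) x (psnd y) \<in> S"
  shows "derivable_from S c x y"
proof -
  have "\<exists>q<c. c = 4 + 4 * q \<and> fact_code (pfst q) x (pfst y) \<in> S \<and> fact_code (psnd q) x (psnd y) \<in> S"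
    using assms by - (rule exI[of _ q], auto)
  then show ?thesis unfolding derivable_from_def by (simp only: simp_thms)
qed

lemma derivable_from_CComp:
  assumes "c = 5 + 4 * q" "fact_code (psnd q) x a \<in> S" "fact_code (pfst q) a y \<in> S"
  shows "derivable_from S c x y"
proof -
  have "\<exists>q<c. c = 5 + 4 * q \<and> (\<exists>a. fact_code (psnd q) x a \<in> S \<and> fact_code (pfst q) a y \<in> S)"
    using assms by - (rule exI[of _ q], auto)
  then show ?thesis unfolding derivable_from_def by (simp only: simp_thms)
qed

lemma derivable_from_CPrec_0:
  assumes "c = 6 + 4 * q" "psnd x = 0" "fact_code (pfst q) (pfst x) y \<in> S"
  shows "derivable_from S c x y"
proof -
  have "\<exists>q<c. c = 6 + 4 * q \<and> psnd x = 0 \<and> fact_code (pfst q) (pfst x) y \<in> S"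
    using assms by - (rule exI[of _ q], auto)
  then show ?thesis unfolding derivable_from_def by (simp only: simp_thms)
qed

lemma derivable_from_CPrec_Suc:
  assumes "c = 6 + 4 * q" "psnd x = Suc m" "fact_code c (prod_encode (pfst x, m)) v \<in> S"
    "fact_code (psnd q) (prod_encode (pfst x, prod_encode (m, v))) y \<in> S"
  shows "derivable_from S c x y"
proof -
  have "\<exists>q<c. c = 6 + 4 * q \<and> (\<exists>m<psnd x. psnd x = Suc m \<and>
        (\<exists>v. fact_code c (prod_encode (pfst x, m)) v \<in> S \<and>
             fact_code (psnd q) (prod_encode (pfst x, prod_encode (m, v))) y \<in> S))"
    using assms by - (rule exI[of _ q], auto)
  then show ?thesis unfolding derivable_from_def by (simp only: simp_thms)
qed

lemma derivable_from_CMin: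
  assumes "c = 7 + 4 * q" "fact_code q (prod_encode (x, y)) 0 \<in> S"
    "\<forall>m<y. \<exists>z. fact_code q (prod_encode (x, m)) (Suc z) \<in> S"
  shows "derivable_from S c x y"
proof -
  have "\<exists>q<c. c = 7 + 4 * q \<and> fact_code q (prod_encode (x, y)) 0 \<in> S \<and>
        (\<forall>m<y. \<exists>z. fact_code q (prod_encode (x, m)) (Suc z) \<in> S)"
    using assms by - (rule exI[of _ q], auto)
  then show ?thesis unfolding derivable_from_def by (simp only: simp_thms)
qed

lemma eval_eventually_computed:
  "eval c x = Some y \<Longrightarrow> \<forall>\<^sub>F s in sequentially. computed_by s (goedel c) x y"
proof (induction c arbitrary: x y)
  case (CPair f g)
  then obtain a b where "eval f x = Some a" "eval g x = Some b" and y: "y = prod_encode (a, b)"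
    by (auto simp: bind_eq_Some_conv)
  with CPair.IH have "\<forall>\<^sub>F s in sequentially. computed_by s (goedel f) x a"
    "\<forall>\<^sub>F s in sequentially. computed_by s (goedel g) x b" by blast+
  then show ?case
  proof (intro eventually_computedI, eventually_elim)
    case (elim s)
    then show ?case
      by (intro derivable_from_CPair[OF goedel.simps(5)]) (simp_all add: computed_by_def y)
  qed
next
  case (CComp f g)
  then obtain a where "eval g x = Some a" "eval f a = Some y"
    by (auto simp: bind_eq_Some_conv)
  with CComp.IH have "\<forall>\<^sub>F s in sequentially. computed_by s (goedel g) x a"
    "\<forall>\<^sub>F s in sequentially. computed_by s (goedel f) a y" by blast+
  then show ?case
  proof (intro eventually_computedI, eventually_elim)
    case (elim s)
    then show ?case
      by (intro derivable_from_CComp[OF goedel.simps(6), where a = a]) (simp_all add: computed_by_def)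
  qed
next
  case (CPrec f g)
  let ?c = "goedel (CPrec f g)"
  \<comment> \<open>The induction over codes says nothing about \<open>CPrec f g\<close> itself at
    smaller recursion arguments, so these need an inner induction.\<close>
  have "eval (CPrec f g) (prod_encode (a, n)) = Some y
    \<Longrightarrow> \<forall>\<^sub>F s in sequentially. computed_by s ?c (prod_encode (a, n)) y" for a n y
  proof (induction n arbitrary: y)
    case 0
    then have "\<forall>\<^sub>F s in sequentially. computed_by s (goedel f) a y" using CPrec.IH(1) by simp
    then show ?case
    proof (intro eventually_computedI, eventually_elim)
      case (elim s)
      then show ?case
        by (intro derivable_from_CPrec_0[OF goedel.simps(7)]) (simp_all add: computed_by_def)
    qed
  next
    case (Suc n)
    then obtain v where v: "eval (CPrec f g) (prod_encode (a, n)) = Some v"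
      "eval g (prod_encode (a, prod_encode (n, v))) = Some y"
      by (auto simp: bind_eq_Some_conv)
    from Suc.IH[OF v(1)] CPrec.IH(2)[OF v(2)] show ?case
    proof (intro eventually_computedI, eventually_elim)
      case (elim s)
      then show ?case
        by (intro derivable_from_CPrec_Suc[OF goedel.simps(7), of _ n _ _ v])
          (simp_all add: computed_by_def)
    qed
  qed
  from this[of "pfst x" "psnd x"] show ?case
    using CPrec.prems by (simp only: prod_encode_collapse[symmetric])
next
  case (CMin f)
  have "phi (7 + 4 * goedel f) x = Some y"
    using CMin.prems by (simp only: phi_def flip: goedel.simps) (simp only: inv_goedel)
  then have "phi (goedel f) (prod_encode (x, y)) = Some 0"
    "\<forall>m<y. \<exists>z. phi (goedel f) (prod_encode (x, m)) = Some (Suc z)"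
    unfolding phi_CMin_iff by blast+
  then have f: "eval f (prod_encode (x, y)) = Some 0"
    "\<forall>m<y. \<exists>z. eval f (prod_encode (x, m)) = Some (Suc z)" by (simp_all add: phi_def)
  \<comment> \<open>The clause for \<open>CMin\<close> needs all earlier values at one common stage;
    there are only finitely many of them.\<close>
  have "\<forall>\<^sub>F s in sequentially. \<forall>m\<in>{..<y}. \<exists>z. computed_by s (goedel f) (prod_encode (x, m)) (Suc z)"
  proof (intro eventually_ball_finite ballI)
    fix m assume "m \<in> {..<y}"
    then obtain z where "eval f (prod_encode (x, m)) = Some (Suc z)" using f(2) by blast
    from CMin.IH[OF this]
    show "\<forall>\<^sub>F s in sequentially. \<exists>z. computed_by s (goedel f) (prod_encode (x, m)) (Suc z)"
      by eventually_elim blast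
  qed simp
  with CMin.IH[OF f(1)] show ?case
  proof (intro eventually_computedI, eventually_elim)
    case (elim s)
    then show ?case
      by (intro derivable_from_CMin[OF goedel.simps(8)]) (simp_all add: computed_by_def)
  qed
qed (intro eventually_computedI always_eventually allI, simp add: derivable_from_def)+

lemma phi_iff_computed_by: "phi e x = Some y \<longleftrightarrow> (\<exists>s. computed_by s e x y)"
proof
  assume "phi e x = Some y"
  then have "\<forall>\<^sub>F s in sequentially. computed_by s (goedel (inv goedel e)) x y"
    unfolding phi_def by (rule eval_eventually_computed)
  then show "\<exists>s. computed_by s e x y" by (simp add: eventually_computed_by_iff)
qed (auto dest: computed_by_sound)

section \<open>Decidability of the stagewise enumeration\<close>

lemma set_decode_less: "k \<in> set_decode d \<Longrightarrow> k < d"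
proof -
  assume "k \<in> set_decode d"
  then have "d div 2 ^ k \<noteq> 0" unfolding set_decode_def by (auto intro!: Nat.gr0I)
  then have "2 ^ k \<le> d" by (simp add: div_eq_0_iff)
  then show ?thesis using less_exp[of k] by linarith
qed

lemma fact_code_set_decode_less: "fact_code c x y \<in> set_decode d \<Longrightarrow> y < d"
  using set_decode_less[of "fact_code c x y" d] le_prod_encode_2[of "prod_encode (x, y)" c]
    le_prod_encode_2[of y x] by linarith

text \<open>Facts coded in \<open>d\<close> have outputs below \<open>d\<close>, so the quantifiers
  over intermediate values can be bounded by \<open>d\<close>.\<close>

lemma derivable_from_set_decode:
  "derivable_from (set_decode d) c x y \<longleftrightarrow>
     c = 0 \<and> y = 0 \<or> c = 1 \<and> y = Suc x \<or> c = 2 \<and> y = pfst x \<or> c = 3 \<and> y = psnd x \<or>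
     (\<exists>q<c. c = 4 + 4 * q \<and> fact_code (pfst q) x (pfst y) \<in> set_decode d \<and>
        fact_code (psnd q) x (psnd y) \<in> set_decode d) \<or>
     (\<exists>q<c. c = 5 + 4 * q \<and> (\<exists>a<d. fact_code (psnd q) x a \<in> set_decode d \<and>
        fact_code (pfst q) a y \<in> set_decode d)) \<or>
     (\<exists>q<c. c = 6 + 4 * q \<and> psnd x = 0 \<and> fact_code (pfst q) (pfst x) y \<in> set_decode d) \<or>
     (\<exists>q<c. c = 6 + 4 * q \<and> (\<exists>m<psnd x. psnd x = Suc m \<and>
        (\<exists>v<d. fact_code c (prod_encode (pfst x, m)) v \<in> set_decode d \<and>
             fact_code (psnd q) (prod_encode (pfst x, prod_encode (m, v))) y \<in> set_decode d))) \<or>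
     (\<exists>q<c. c = 7 + 4 * q \<and> fact_code q (prod_encode (x, y)) 0 \<in> set_decode d \<and>
        (\<forall>m<y. \<exists>z<d. fact_code q (prod_encode (x, m)) (Suc z) \<in> set_decode d))"
proof -
  have "(\<exists>a. fact_code c x a \<in> set_decode d \<and> R a) \<longleftrightarrow>
    (\<exists>a<d. fact_code c x a \<in> set_decode d \<and> R a)" for c x R
    using fact_code_set_decode_less by blast
  moreover have "(\<exists>z. fact_code c x (Suc z) \<in> set_decode d) \<longleftrightarrow>
    (\<exists>z<d. fact_code c x (Suc z) \<in> set_decode d)" for c x
    using fact_code_set_decode_less Suc_lessD by blast
  ultimately show ?thesis unfolding derivable_from_def by (simp only:)
qed

lemma dec_derivable_from:
  "decidable (\<lambda>z. derivable_from (set_decode (pfst z)) (pfst (psnd z))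
     (pfst (psnd (psnd z))) (psnd (psnd (psnd z))))"
  unfolding derivable_from_set_decode by (intro recursive_intros dec_set_decode)

lemma finite_facts: "finite (facts s)"
  by (rule finite_subset[of _ "{..<s}"]) (auto dest: facts_bound)

text \<open>A whole stage is one number, the sum of its powers of two, so primitive recursion over
  stages suffices.\<close>

lemma set_encode_facts:
  "set_encode (facts s) = rec_nat 0 (\<lambda>s d. \<Sum>k<Suc s.
     if derivable_from (set_decode d) (pfst k) (pfst (psnd k)) (psnd (psnd k)) then 2 ^ k else 0) s"
proof (induction s)
  case 0
  then show ?case by (simp add: set_encode_def)
next
  case (Suc s)
  have "set_decode (set_encode (facts s)) = facts s" by (simp add: finite_facts)
  moreover have "facts (Suc s) = {k \<in> {..<Suc s}. derivable_from (facts s) (pfst k) (pfst (psnd k)) (psnd (psnd k))}"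
    by auto
  then have "set_encode (facts (Suc s)) = (\<Sum>k<Suc s.
     if derivable_from (facts s) (pfst k) (pfst (psnd k)) (psnd (psnd k)) then 2 ^ k else 0)"
    unfolding set_encode_def by (simp only: sum.inter_filter finite_lessThan)
  ultimately show ?case using Suc by simp
qed

lemma tr_set_encode_facts: "total_recursive (\<lambda>s. set_encode (facts s))"
proof -
  have *: "decidable (\<lambda>z. derivable_from (set_decode (psnd (psnd (pfst z)))) (pfst (psnd z))
     (pfst (psnd (psnd z))) (psnd (psnd (psnd z))))"
    using dec_comp[OF dec_derivable_from, of "\<lambda>z. prod_encode (psnd (psnd (pfst z)), psnd z)"]
    by (simp add: tr_pair tr_pfst tr_psnd tr_id)
  show ?thesis
    unfolding set_encode_facts by (intro recursive_intros *)
qed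

lemma dec_computed_by:
  assumes "total_recursive s" "total_recursive e" "total_recursive x" "total_recursive y"
  shows "decidable (\<lambda>z. computed_by (s z) (e z) (x z) (y z))"
proof -
  have "decidable (\<lambda>z. fact_code (e z) (x z) (y z) \<in> set_decode (set_encode (facts (s z))))"
    by (intro dec_set_decode tr_pair assms tr_comp[OF tr_set_encode_facts])
  then show ?thesis by (simp add: computed_by_def finite_facts)
qed


section \<open>Measures on Cantor space from additive set functions on strings\<close>

lemma initial_segment_Suc: "initial_segment X (Suc n) = initial_segment X n @ [X n]"
  by (simp add: initial_segment_def)

lemma length_initial_segment [simp]: "length (initial_segment X n) = n"
  by (simp add: initial_segment_def)

text \<open>
  The measure is the image of Lebesgue measure on the unit interval: cut the interval into
  consecutive intervals \<open>[l \<sigma>, l \<sigma> + m \<sigma>)\<close>, nested along extension of strings, and map a point to the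
  sequence whose intervals contain it.
\<close>

lemma cantor_measure_exists:
  fixes m :: "bool list \<Rightarrow> real"
  assumes nonneg: "\<And>\<sigma>. 0 \<le> m \<sigma>" and total: "m [] = 1"
    and additive: "\<And>\<sigma>. m \<sigma> = m (\<sigma> @ [False]) + m (\<sigma> @ [True])"
  shows "\<exists>\<mu>. cantor_measure \<mu> \<and> (\<forall>\<sigma>. measure \<mu> (cylinder \<sigma>) = m \<sigma>)"
proof -
  \<comment> \<open>The mass of all strings of the same length to the left of
    \<open>\<sigma>\<close>: each bit \<open>True\<close> skips the mass of its \<open>False\<close>
    sibling.\<close>
  define l where "l \<sigma> = (\<Sum>i<length \<sigma>. if \<sigma> ! i then m (take i \<sigma> @ [False]) else 0)" for \<sigma>
  have l_Nil: "l [] = 0" by (simp add: l_def)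
  have l_snoc: "l (\<sigma> @ [b]) = l \<sigma> + (if b then m (\<sigma> @ [False]) else 0)" for \<sigma> b
    unfolding l_def by (simp add: nth_append) (rule sum.cong, simp_all)
  have l_bounds: "0 \<le> l \<sigma> \<and> l \<sigma> + m \<sigma> \<le> 1" for \<sigma>
  proof (induction \<sigma> rule: rev_induct)
    case Nil
    then show ?case by (simp add: l_Nil total)
  next
    case (snoc b \<sigma>)
    then show ?case
      using nonneg[of "\<sigma> @ [False]"] nonneg[of "\<sigma> @ [True]"] additive[of \<sigma>]
      by (cases b) (simp_all add: l_snoc)
  qed
  define path where "path u = rec_nat [] (\<lambda>_ \<sigma>. \<sigma> @ [l \<sigma> + m (\<sigma> @ [False]) \<le> u])" for u :: real
  define X where "X u = (\<lambda>n. l (path u n) + m (path u n @ [False]) \<le> u)" for u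
  have path_Suc: "path u (Suc n) = path u n @ [X u n]" for u n
    by (simp add: path_def X_def)
  have path: "initial_segment (X u) n = path u n" for u n
  proof (induction n)
    case 0
    then show ?case by (simp add: initial_segment_def path_def)
  next
    case (Suc n)
    then show ?case by (simp add: initial_segment_Suc path_Suc)
  qed
  have in_cylinder: "X u \<in> cylinder \<sigma> \<longleftrightarrow> path u (length \<sigma>) = \<sigma>" for u \<sigma>
    by (simp add: cylinder_def path)
  have in_snoc: "X u \<in> cylinder (\<sigma> @ [b]) \<longleftrightarrow>
      X u \<in> cylinder \<sigma> \<and> (b \<longleftrightarrow> l \<sigma> + m (\<sigma> @ [False]) \<le> u)" for u \<sigma> b
    unfolding in_cylinder by (auto simp: path_Suc X_def)
  have interval: "X u \<in> cylinder \<sigma> \<longleftrightarrow> u \<in> {l \<sigma>..<l \<sigma> + m \<sigma>}" if "u \<in> {0..<1}" for u \<sigma>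
  proof (induction \<sigma> rule: rev_induct)
    case Nil
    then show ?case using that by (simp add: cylinder_altdef l_Nil total)
  next
    case (snoc b \<sigma>)
    then show ?case
      using nonneg[of "\<sigma> @ [False]"] nonneg[of "\<sigma> @ [True]"] additive[of \<sigma>]
      by (cases b) (auto simp: in_snoc l_snoc)
  qed
  \<comment> \<open>\<open>interval\<close> locates the preimage only within \<open>{0..<1}\<close>;
    measurability concerns all reals, hence a separate induction with half-lines.\<close>
  have pre: "X -` cylinder \<sigma> \<in> sets borel" for \<sigma>
  proof (induction \<sigma> rule: rev_induct)
    case Nil
    then show ?case by (simp add: cylinder_altdef)
  next
    case (snoc b \<sigma>)
    have "X -` cylinder (\<sigma> @ [b]) = X -` cylinder \<sigma> \<inter>
        (if b then {l \<sigma> + m (\<sigma> @ [False])..} else {..<l \<sigma> + m (\<sigma> @ [False])})"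
      by (auto simp: in_snoc)
    then show ?case using snoc by simp
  qed
  let ?U = "uniform_measure lborel {0..<1::real}"
  have X_meas: "X \<in> measurable ?U borel"
  proof (rule measurable_sigma_sets[OF borel_eq_sigma_cylinders])
    fix A assume "A \<in> insert {} (range cylinder)"
    then show "X -` A \<inter> space ?U \<in> sets ?U" using pre by auto
  qed auto
  interpret U: prob_space ?U
    by (rule prob_space_uniform_measure) simp_all
  define \<mu> where "\<mu> = distr ?U borel X"
  have "prob_space \<mu>" unfolding \<mu>_def by (rule U.prob_space_distr[OF X_meas])
  moreover have "measure \<mu> (cylinder \<sigma>) = m \<sigma>" for \<sigma>
  proof -
    have "{0..<1} \<inter> X -` cylinder \<sigma> = {l \<sigma>..<l \<sigma> + m \<sigma>}"
      using interval[of _ \<sigma>] l_bounds[of \<sigma>] by auto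
    moreover have "measure \<mu> (cylinder \<sigma>) = measure ?U (X -` cylinder \<sigma>)"
      unfolding \<mu>_def by (subst measure_distr[OF X_meas]) (simp_all add: open_cylinder)
    moreover have "\<dots> = measure lborel ({0..<1} \<inter> X -` cylinder \<sigma>) / measure lborel {0..<1::real}"
      using pre by (intro measure_uniform_measure) simp_all
    ultimately show ?thesis using nonneg[of \<sigma>] by simp
  qed
  ultimately show ?thesis
    unfolding cantor_measure_def by (intro exI[of _ \<mu>]) (simp add: \<mu>_def)
qed


section \<open>Decidable approximations to conflicts and to a universal test\<close>

text \<open>The sequences with finitely many ones, indexed by numbers. Every string is an initial
  segment of one of them, so quantifiers over strings become quantifiers over \<open>r\<close> and a
  length, without decoding \<open>list_encode\<close>.\<close>

definition bitseq :: "nat \<Rightarrow> nat \<Rightarrow> bool" where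
  "bitseq r i \<longleftrightarrow> i \<in> set_decode r"

abbreviation seg :: "(nat \<Rightarrow> bool) \<Rightarrow> nat \<Rightarrow> nat" where
  "seg X n \<equiv> string_encode (initial_segment X n)"

lemma string_encode_inject: "string_encode \<sigma> = string_encode \<tau> \<longleftrightarrow> \<sigma> = \<tau>"
proof -
  have "inj (of_bool :: bool \<Rightarrow> nat)" by (auto simp: inj_def)
  then show ?thesis by (simp add: string_encode_def list_encode_eq inj_map_eq_map)
qed

lemma list_encode_ge_length: "length xs \<le> list_encode xs"
proof (induction xs)
  case (Cons x xs)
  then show ?case using le_prod_encode_2[of "list_encode xs" x] by simp
qed simp

lemma seg_ge: "k \<le> seg X k"
  using list_encode_ge_length[of "map of_bool (initial_segment X k)"] by (simp add: string_encode_def)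

lemma seg_inject: "seg X k = seg Y j \<longleftrightarrow> initial_segment X k = initial_segment Y j"
  by (rule string_encode_inject)

lemma bitseq_surj: "\<exists>r<2 ^ n. \<forall>i<n. bitseq r i = X i"
proof -
  let ?A = "{i. i < n \<and> X i}"
  have "set_encode ?A \<le> (\<Sum>i<n. 2 ^ i)"
    unfolding set_encode_def by (intro sum_mono2) auto
  moreover have "(\<Sum>i<n. 2 ^ i) < (2 ^ n :: nat)" by (induction n) auto
  ultimately show ?thesis
    by (intro exI[of _ "set_encode ?A"]) (auto simp: bitseq_def)
qed

lemma string_eq_bitseq:
  "\<exists>r<2 ^ length \<sigma>. initial_segment (bitseq r) (length \<sigma>) = \<sigma>"
proof -
  obtain r where "r < 2 ^ length \<sigma>" "\<forall>i<length \<sigma>. bitseq r i = \<sigma> ! i"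
    using bitseq_surj[of "length \<sigma>" "(!) \<sigma>"] by blast
  then show ?thesis by (intro exI[of _ r]) (auto simp: initial_segment_def intro: nth_equalityI)
qed

text \<open>A number below \<open>2 ^ n\<close> has no binary digit at or above position
  \<open>n\<close>.\<close>

lemma bitseq_inject:
  assumes "r < 2 ^ n" "r' < 2 ^ n" "\<forall>i<n. bitseq r i = bitseq r' i"
  shows "r = r'"
proof -
  have "i < n" if "i \<in> set_decode r" "r < 2 ^ n" for i r
  proof (rule ccontr)
    assume "\<not> i < n"
    then have "(2::nat) ^ n \<le> 2 ^ i" by (intro power_increasing) simp_all
    then have "r div 2 ^ i = 0" using that(2) by (intro div_less) linarith
    then show False using that(1) by (simp add: set_decode_def)
  qed
  then have "set_decode r = set_decode r'" using assms unfolding bitseq_def by blast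
  then show ?thesis by (metis set_decode_inverse)
qed

lemma tr_seg:
  assumes "total_recursive r" "total_recursive k"
  shows "total_recursive (\<lambda>z. seg (bitseq (r z)) (k z))"
proof -
  \<comment> \<open>\<open>Suc (prod_encode (x, v))\<close> is the code of a cons, and lists grow at
    the front, so the recursion visits the bits from \<open>k - 1\<close> down to
    \<open>0\<close>.\<close>
  let ?R = "\<lambda>z. rec_nat 0 (\<lambda>j v. Suc (prod_encode (of_bool (psnd z - Suc j \<in> set_decode (pfst z)), v)))"
  have "?R (prod_encode (r, k)) j = list_encode (map (\<lambda>i. of_bool (bitseq r i)) [k - j..<k])"
    if "j \<le> k" for r k j
    using that
  proof (induction j)
    case (Suc j)
    then have "[k - Suc j..<k] = (k - Suc j) # [k - j..<k]"
      using upt_conv_Cons[of "k - Suc j" k] by (simp add: Suc_diff_Suc)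
    then show ?case using Suc by (simp add: bitseq_def)
  qed simp
  from this[of k k for k] have "?R (prod_encode (r, k)) k = seg (bitseq r) k" for r k
    by (simp add: string_encode_def initial_segment_def comp_def)
  moreover have "total_recursive (\<lambda>z. ?R z (psnd z))"
    by (intro recursive_intros dec_set_decode)
  from tr_comp[OF this tr_pair[OF assms]]
  have "total_recursive (\<lambda>z. ?R (prod_encode (r z, k z)) (k z))" by simp
  ultimately show ?thesis by (simp only:)
qed

definition halted :: "nat \<Rightarrow> nat \<Rightarrow> nat \<Rightarrow> bool" where
  "halted s e x \<longleftrightarrow> (\<exists>y<s. computed_by s e x y)"

text \<open>A sum instead of a search: at most one candidate is ever computed, and 0 is the default
  before halting.\<close>

definition output_by :: "nat \<Rightarrow> nat \<Rightarrow> nat \<Rightarrow> nat" where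
  "output_by s e x = (\<Sum>y<s. y * of_bool (computed_by s e x y))"

lemma halted_iff: "halted s e x \<longleftrightarrow> (\<exists>y. computed_by s e x y)"
  unfolding halted_def using computed_by_bound by blast

lemma eventually_computed_by:
  "phi e x = Some y \<Longrightarrow> \<forall>\<^sub>F s in sequentially. computed_by s e x y"
  unfolding eventually_computed_by_iff by (simp add: phi_iff_computed_by)

lemma eventually_halted: "phi e x \<noteq> None \<Longrightarrow> \<forall>\<^sub>F s in sequentially. halted s e x"
  using eventually_computed_by by (fastforce simp: halted_iff elim: eventually_mono)

lemma halted_imp: "halted s e x \<Longrightarrow> phi e x \<noteq> None"
  by (auto simp: halted_iff dest: computed_by_sound)

lemma output_by_eq:
  assumes "halted s e x"
  shows "phi e x = Some (output_by s e x)"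
proof -
  obtain y where y: "computed_by s e x y" "y < s" using assms unfolding halted_def by blast
  have "computed_by s e x z \<longleftrightarrow> z = y" for z
    using y(1) computed_by_sound[OF y(1)] computed_by_sound[of s e x z] by auto
  then have "output_by s e x = (\<Sum>z\<in>{..<s}. if z = y then y else 0)"
    unfolding output_by_def by (intro sum.cong) auto
  also have "\<dots> = y" using y(2) by simp
  finally show ?thesis using computed_by_sound[OF y(1)] by simp
qed

lemma dec_halted:
  assumes "total_recursive s" "total_recursive e" "total_recursive x"
  shows "decidable (\<lambda>z. halted (s z) (e z) (x z))"
proof -
  have "decidable (\<lambda>z. halted (pfst z) (pfst (psnd z)) (psnd (psnd z)))"
    unfolding halted_def by (intro recursive_intros dec_computed_by)
  from dec_comp[OF this tr_pair[OF assms(1) tr_pair[OF assms(2,3)]]] show ?thesis by simp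
qed

lemma tr_output_by:
  assumes "total_recursive s" "total_recursive e" "total_recursive x"
  shows "total_recursive (\<lambda>z. output_by (s z) (e z) (x z))"
proof -
  have "total_recursive (\<lambda>z. output_by (pfst z) (pfst (psnd z)) (psnd (psnd z)))"
    unfolding output_by_def by (intro recursive_intros dec_computed_by)
  from tr_comp[OF this tr_pair[OF assms(1) tr_pair[OF assms(2,3)]]] show ?thesis by simp
qed

section \<open>Inconsistent approximations\<close>

text \<open>\<open>y / 2 ^ n\<close> exceeds \<open>y' / 2 ^ n'\<close> by more than the two
  permitted errors \<open>1 / 2 ^ n\<close> and \<open>1 / 2 ^ n'\<close>, with denominators
  cleared.\<close>

definition approx_conflict :: "nat \<Rightarrow> nat \<Rightarrow> bool" where
  "approx_conflict e w \<longleftrightarrow> (\<exists>r<w. \<exists>k<w. \<exists>n<w. \<exists>n'<w. \<exists>y<w. \<exists>y'<w.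
     computed_by w e (prod_encode (seg (bitseq r) k, n)) y \<and>
     computed_by w e (prod_encode (seg (bitseq r) k, n')) y' \<and>
     y' * 2 ^ n + 2 ^ n + 2 ^ n' < y * 2 ^ n')"

text \<open>The argument 0 is the code of the empty string, whose cylinder must have measure
  1.\<close>

definition mass_conflict :: "nat \<Rightarrow> nat \<Rightarrow> bool" where
  "mass_conflict e w \<longleftrightarrow> (\<exists>n<w. \<exists>y<w. computed_by w e (prod_encode (0, n)) y \<and>
     (2 ^ n + 1 < y \<or> y + 1 < 2 ^ n))"

text \<open>\<open>r\<close> and \<open>r'\<close> continue the same string of length
  \<open>k\<close> by \<open>False\<close> and \<open>True\<close>. The tolerance 3 is one unit of
  error for each of the three approximations.\<close>

definition additivity_conflict :: "nat \<Rightarrow> nat \<Rightarrow> bool" where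
  "additivity_conflict e w \<longleftrightarrow> (\<exists>r<w. \<exists>r'<w. \<exists>k<w. \<exists>n<w. \<exists>y<w. \<exists>y0<w. \<exists>y1<w.
     seg (bitseq r) k = seg (bitseq r') k \<and> k \<notin> set_decode r \<and> k \<in> set_decode r' \<and>
     computed_by w e (prod_encode (seg (bitseq r) k, n)) y \<and>
     computed_by w e (prod_encode (seg (bitseq r) (Suc k), n)) y0 \<and>
     computed_by w e (prod_encode (seg (bitseq r') (Suc k), n)) y1 \<and>
     (y + 3 < y0 + y1 \<or> y0 + y1 + 3 < y))"

definition conflict :: "nat \<Rightarrow> nat \<Rightarrow> bool" where
  "conflict e w \<longleftrightarrow> approx_conflict e w \<or> mass_conflict e w \<or> additivity_conflict e w"

lemma dec_conflict:
  assumes "total_recursive e" "total_recursive w"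
  shows "decidable (\<lambda>z. conflict (e z) (w z))"
proof -
  have "decidable (\<lambda>z. approx_conflict (pfst z) (psnd z))"
    unfolding approx_conflict_def by (intro recursive_intros dec_computed_by tr_seg)
  moreover have "decidable (\<lambda>z. mass_conflict (pfst z) (psnd z))"
    unfolding mass_conflict_def by (intro recursive_intros dec_computed_by tr_seg)
  moreover have "decidable (\<lambda>z. additivity_conflict (pfst z) (psnd z))"
    unfolding additivity_conflict_def by (intro recursive_intros dec_computed_by tr_seg dec_set_decode)
  ultimately have "decidable (\<lambda>z. conflict (pfst z) (psnd z))"
    unfolding conflict_def by (intro dec_disj)
  from dec_comp[OF this tr_pair[OF assms]] show ?thesis by simp
qed

section \<open>The universal test\<close>

text \<open>The \<open>a\<close>-th test is the domain of \<open>phi a\<close>, read as pairs of a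
  level and a string code; \<open>z < s\<close> makes every stage finite.\<close>

definition enumerated :: "nat \<Rightarrow> nat \<Rightarrow> nat \<Rightarrow> nat \<Rightarrow> bool" where
  "enumerated s a m z \<longleftrightarrow> z < s \<and> halted s a (prod_encode (m, z))"

definition stage_covers :: "nat \<Rightarrow> nat \<Rightarrow> nat \<Rightarrow> (nat \<Rightarrow> bool) \<Rightarrow> bool" where
  "stage_covers s a m X \<longleftrightarrow> (\<exists>k<s. enumerated s a m (seg X k))"

text \<open>
  Up to an error of \<open>2 ^ s\<close> this is \<open>2 ^ (s + m)\<close> times the measure of the set enumerated by stage
  \<open>s\<close> into level \<open>m\<close> of the \<open>a\<close>-th test.
\<close>

definition stage_sum :: "nat \<Rightarrow> nat \<Rightarrow> nat \<Rightarrow> nat \<Rightarrow> nat \<Rightarrow> nat" where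
  "stage_sum w e s a m = (\<Sum>r<2 ^ s. if stage_covers s a m (bitseq r)
     then output_by w e (prod_encode (seg (bitseq r) s, s + m)) else 0)"

text \<open>At precision \<open>s + m\<close> the \<open>2 ^ s\<close> approximations err by at most
  \<open>2 ^ s\<close> units in total, and measure \<open>1 / 2 ^ m\<close> amounts to
  \<open>2 ^ s\<close> units: hence the threshold \<open>2 ^ Suc s\<close>. The clause on
  \<open>halted\<close> keeps the default output 0 from passing for a small measure.\<close>

definition stage_small :: "nat \<Rightarrow> nat \<Rightarrow> nat \<Rightarrow> nat \<Rightarrow> nat \<Rightarrow> bool" where
  "stage_small w e s a m \<longleftrightarrow>
     (\<forall>r<2 ^ s. halted w e (prod_encode (seg (bitseq r) s, s + m))) \<and>
     stage_sum w e s a m \<le> 2 ^ Suc s"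

text \<open>
  Level \<open>c\<close> of the universal test collects, for every \<open>a\<close>, the stages of level \<open>a + c + 3\<close> of the
  \<open>a\<close>-th test whose measure looks small; each contributes at most \<open>3 / 2 ^ (a + c + 3)\<close>.
\<close>

definition hit :: "nat \<Rightarrow> nat \<Rightarrow> nat \<Rightarrow> nat \<Rightarrow> bool" where
  "hit e c z w \<longleftrightarrow> (\<exists>s<w. \<exists>a<w. enumerated s a (a + c + 3) z \<and> stage_small w e s a (a + c + 3))"

lemma dec_stage_small:
  assumes "total_recursive w" "total_recursive e" "total_recursive s" "total_recursive a"
    "total_recursive m"
  shows "decidable (\<lambda>z. stage_small (w z) (e z) (s z) (a z) (m z))"
proof -
  have "decidable (\<lambda>z. stage_small (pfst z) (pfst (psnd z)) (pfst (psnd (psnd z)))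
    (pfst (psnd (psnd (psnd z)))) (psnd (psnd (psnd (psnd z)))))"
    unfolding stage_small_def stage_sum_def stage_covers_def enumerated_def
    by (intro recursive_intros dec_halted tr_output_by tr_seg)
  from dec_comp[OF this tr_pair[OF assms(1) tr_pair[OF assms(2) tr_pair[OF assms(3) tr_pair[OF assms(4,5)]]]]]
  show ?thesis by simp
qed

lemma dec_hit:
  assumes "total_recursive e" "total_recursive c" "total_recursive x" "total_recursive w"
  shows "decidable (\<lambda>z. hit (e z) (c z) (x z) (w z))"
proof -
  have "decidable (\<lambda>z. hit (pfst z) (pfst (psnd z)) (pfst (psnd (psnd z))) (psnd (psnd (psnd z))))"
    unfolding hit_def enumerated_def
    by (intro recursive_intros dec_halted dec_stage_small)
  from dec_comp[OF this tr_pair[OF assms(1) tr_pair[OF assms(2) tr_pair[OF assms(3,4)]]]]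
  show ?thesis by simp
qed


section \<open>Indices of computable measures\<close>

lemma ex_lessI: "k < w \<Longrightarrow> P k \<Longrightarrow> \<exists>k<w. P k" for k w :: nat
  by blast

text \<open>All bounds by \<open>w\<close> hold once \<open>w\<close> is large, so only the values
  of \<open>phi e\<close> matter; likewise for the next two kinds of conflict.\<close>

lemma approx_conflict_iff:
  "(\<exists>w. approx_conflict e w) \<longleftrightarrow> (\<exists>\<sigma> n n' y y'. phi e (prod_encode (string_encode \<sigma>, n)) = Some y \<and>
     phi e (prod_encode (string_encode \<sigma>, n')) = Some y' \<and> y' * 2 ^ n + 2 ^ n + 2 ^ n' < y * 2 ^ n')"
  (is "_ \<longleftrightarrow> ?R")
proof
  assume ?R
  then obtain \<sigma> n n' y y' where *: "phi e (prod_encode (string_encode \<sigma>, n)) = Some y"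
    "phi e (prod_encode (string_encode \<sigma>, n')) = Some y'" "y' * 2 ^ n + 2 ^ n + 2 ^ n' < y * 2 ^ n'"
    by blast
  obtain r k where r: "initial_segment (bitseq r) k = \<sigma>" using string_eq_bitseq by blast
  have "\<forall>\<^sub>F w in sequentially. approx_conflict e w"
    using eventually_computed_by[OF *(1), folded r] eventually_computed_by[OF *(2), folded r]
      eventually_gt_at_top[of r] eventually_gt_at_top[of k] eventually_gt_at_top[of n]
      eventually_gt_at_top[of n'] eventually_gt_at_top[of y] eventually_gt_at_top[of y']
  proof eventually_elim
    case (elim w)
    show ?case
      unfolding approx_conflict_def
      by (rule ex_lessI[OF elim(3)], rule ex_lessI[OF elim(4)], rule ex_lessI[OF elim(5)], rule ex_lessI[OF elim(6)], rule ex_lessI[OF elim(7)], rule ex_lessI[OF elim(8)],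
          intro conjI elim *(3))
  qed
  then show "\<exists>w. approx_conflict e w" unfolding eventually_sequentially by blast
next
  assume "\<exists>w. approx_conflict e w"
  then show ?R unfolding approx_conflict_def by (blast dest: computed_by_sound)
qed

lemma mass_conflict_iff:
  "(\<exists>w. mass_conflict e w) \<longleftrightarrow> (\<exists>n y. phi e (prod_encode (string_encode [], n)) = Some y \<and>
     (2 ^ n + 1 < y \<or> y + 1 < 2 ^ n))"
  (is "_ \<longleftrightarrow> ?R")
proof
  assume ?R
  then obtain n y where *: "phi e (prod_encode (string_encode [], n)) = Some y"
    "2 ^ n + 1 < y \<or> y + 1 < 2 ^ n" by blast
  have "\<forall>\<^sub>F w in sequentially. mass_conflict e w"
    using eventually_computed_by[OF *(1)] eventually_gt_at_top[of n] eventually_gt_at_top[of y]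
    by eventually_elim
      (use *(2) in \<open>unfold mass_conflict_def string_encode_def list.map list_encode.simps, blast\<close>)
  then show "\<exists>w. mass_conflict e w" unfolding eventually_sequentially by blast
next
  assume "\<exists>w. mass_conflict e w"
  then show ?R
    unfolding mass_conflict_def by (simp add: string_encode_def) (blast dest: computed_by_sound)
qed

lemma additivity_conflict_iff:
  "(\<exists>w. additivity_conflict e w) \<longleftrightarrow> (\<exists>\<sigma> n y y0 y1.
     phi e (prod_encode (string_encode \<sigma>, n)) = Some y \<and>
     phi e (prod_encode (string_encode (\<sigma> @ [False]), n)) = Some y0 \<and>
     phi e (prod_encode (string_encode (\<sigma> @ [True]), n)) = Some y1 \<and>
     (y + 3 < y0 + y1 \<or> y0 + y1 + 3 < y))"
  (is "_ \<longleftrightarrow> ?R")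
proof
  assume ?R
  then obtain \<sigma> n y y0 y1 where *: "phi e (prod_encode (string_encode \<sigma>, n)) = Some y"
    "phi e (prod_encode (string_encode (\<sigma> @ [False]), n)) = Some y0"
    "phi e (prod_encode (string_encode (\<sigma> @ [True]), n)) = Some y1"
    "y + 3 < y0 + y1 \<or> y0 + y1 + 3 < y"
    by blast
  obtain r r' k where r: "initial_segment (bitseq r) (Suc k) = \<sigma> @ [False]"
      "initial_segment (bitseq r') (Suc k) = \<sigma> @ [True]"
    using string_eq_bitseq[of "\<sigma> @ [False]"] string_eq_bitseq[of "\<sigma> @ [True]"] by auto
  then have \<sigma>: "initial_segment (bitseq r) k = \<sigma>"
    and r': "seg (bitseq r) k = seg (bitseq r') k" "\<not> bitseq r k" "bitseq r' k"
    by (simp_all add: initial_segment_Suc)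
  have "\<forall>\<^sub>F w in sequentially. additivity_conflict e w"
    using eventually_computed_by[OF *(1), folded \<sigma>] eventually_computed_by[OF *(2), folded r]
      eventually_computed_by[OF *(3), folded r]
      eventually_gt_at_top[of r] eventually_gt_at_top[of r'] eventually_gt_at_top[of k]
      eventually_gt_at_top[of n]
      eventually_gt_at_top[of y] eventually_gt_at_top[of y0] eventually_gt_at_top[of y1]
  proof eventually_elim
    case (elim w)
    show ?case
      unfolding additivity_conflict_def bitseq_def[symmetric]
      by (rule ex_lessI[OF elim(4)], rule ex_lessI[OF elim(5)], rule ex_lessI[OF elim(6)], rule ex_lessI[OF elim(7)], rule ex_lessI[OF elim(8)], rule ex_lessI[OF elim(9)], rule ex_lessI[OF elim(10)],
          intro conjI elim r' *(4))
  qed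
  then show "\<exists>w. additivity_conflict e w" unfolding eventually_sequentially by blast
next
  assume "\<exists>w. additivity_conflict e w"
  then obtain w r r' k n y y0 y1 where
    *: "seg (bitseq r) k = seg (bitseq r') k" "\<not> bitseq r k" "bitseq r' k"
      "computed_by w e (prod_encode (seg (bitseq r) k, n)) y"
      "computed_by w e (prod_encode (seg (bitseq r) (Suc k), n)) y0"
      "computed_by w e (prod_encode (seg (bitseq r') (Suc k), n)) y1"
      "y + 3 < y0 + y1 \<or> y0 + y1 + 3 < y"
    unfolding additivity_conflict_def bitseq_def[symmetric] by blast
  let ?\<sigma> = "initial_segment (bitseq r) k"
  have eq: "initial_segment (bitseq r) (Suc k) = ?\<sigma> @ [False]"
    "initial_segment (bitseq r') (Suc k) = ?\<sigma> @ [True]"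
    using * by (simp_all add: initial_segment_Suc seg_inject)
  show ?R
    by (rule exI[of _ ?\<sigma>], rule exI[of _ n], rule exI[of _ y], rule exI[of _ y0], rule exI[of _ y1],
        intro conjI computed_by_sound[OF *(4)] computed_by_sound[OF *(5), unfolded eq]
          computed_by_sound[OF *(6), unfolded eq] *(7))
qed

lemma computes_measure_approx:
  assumes "computes_measure f \<mu>" and y: "f (prod_encode (string_encode \<sigma>, n)) = Some y"
  shows "\<bar>measure \<mu> (cylinder \<sigma>) * 2 ^ n - real y\<bar> \<le> 1"
proof -
  obtain k where "f (prod_encode (string_encode \<sigma>, n)) = Some k"
    "\<bar>measure \<mu> (cylinder \<sigma>) - real k / 2 ^ n\<bar> \<le> 1 / 2 ^ n"
    using assms(1) unfolding computes_measure_def by blast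
  with y have le: "\<bar>measure \<mu> (cylinder \<sigma>) - real y / 2 ^ n\<bar> \<le> 1 / 2 ^ n" by simp
  have "measure \<mu> (cylinder \<sigma>) * 2 ^ n - real y = (measure \<mu> (cylinder \<sigma>) - real y / 2 ^ n) * 2 ^ n"
    by (simp add: left_diff_distrib)
  then have "\<bar>measure \<mu> (cylinder \<sigma>) * 2 ^ n - real y\<bar> = \<bar>measure \<mu> (cylinder \<sigma>) - real y / 2 ^ n\<bar> * 2 ^ n"
    by (simp only: abs_mult) simp
  also have "\<dots> \<le> 1 / 2 ^ n * 2 ^ n" by (intro mult_right_mono le) simp
  finally show ?thesis by simp
qed

text \<open>Each tolerance is the sum of the errors involved, so correct approximations never exceed
  it.\<close>

lemma computes_measure_imp_no_conflict:
  assumes "computes_measure (phi e) \<mu>"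
  shows "\<not> conflict e w"
proof -
  interpret prob_space \<mu> using assms by (simp add: computes_measure_def cantor_measure_def)
  have sets_\<mu>: "sets \<mu> = sets borel" using assms by (simp add: computes_measure_def cantor_measure_def)
  note approx' = computes_measure_approx[OF assms]
  have "\<not> approx_conflict e w"
  proof
    assume "approx_conflict e w"
    then obtain \<sigma> n n' y y' where *: "phi e (prod_encode (string_encode \<sigma>, n)) = Some y"
      "phi e (prod_encode (string_encode \<sigma>, n')) = Some y'" "y' * 2 ^ n + 2 ^ n + 2 ^ n' < y * 2 ^ n'"
      using approx_conflict_iff by blast
    let ?p = "measure \<mu> (cylinder \<sigma>)"
    have "real y * 2 ^ n' \<le> (?p * 2 ^ n + 1) * 2 ^ n'"
      using approx'[OF *(1)] by (intro mult_right_mono) auto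
    moreover have "(?p * 2 ^ n' - 1) * 2 ^ n \<le> real y' * 2 ^ n"
      using approx'[OF *(2)] by (intro mult_right_mono) auto
    ultimately have "real y * 2 ^ n' \<le> real y' * 2 ^ n + 2 ^ n + 2 ^ n'"
      by (simp add: algebra_simps)
    moreover have "real (y' * 2 ^ n + 2 ^ n + 2 ^ n') < real (y * 2 ^ n')"
      using *(3) by (simp only: of_nat_less_iff)
    ultimately show False by simp
  qed
  moreover have "\<not> mass_conflict e w"
  proof
    assume "mass_conflict e w"
    then obtain n y where *: "phi e (prod_encode (string_encode [], n)) = Some y"
      "2 ^ n + 1 < y \<or> y + 1 < 2 ^ n" using mass_conflict_iff by blast
    have "measure \<mu> (cylinder []) = 1"
      using prob_space sets_eq_imp_space_eq[OF sets_\<mu>] by (simp add: cylinder_altdef)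
    with approx'[OF *(1)] have "\<bar>2 ^ n - real y\<bar> \<le> 1" by simp
    moreover have "real (2 ^ n + 1) < real y \<or> real (y + 1) < real (2 ^ n)"
      using *(2) by (simp only: of_nat_less_iff)
    ultimately show False by auto
  qed
  moreover have "\<not> additivity_conflict e w"
  proof
    assume "additivity_conflict e w"
    then obtain \<sigma> n y y0 y1 where *: "phi e (prod_encode (string_encode \<sigma>, n)) = Some y"
      "phi e (prod_encode (string_encode (\<sigma> @ [False]), n)) = Some y0"
      "phi e (prod_encode (string_encode (\<sigma> @ [True]), n)) = Some y1"
      "y + 3 < y0 + y1 \<or> y0 + y1 + 3 < y"
      using additivity_conflict_iff by blast
    have "cylinder \<sigma> = cylinder (\<sigma> @ [False]) \<union> cylinder (\<sigma> @ [True])"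
      "cylinder (\<sigma> @ [False]) \<inter> cylinder (\<sigma> @ [True]) = {}"
      by (auto simp: cylinder_def initial_segment_Suc)
    then have "measure \<mu> (cylinder \<sigma>) = measure \<mu> (cylinder (\<sigma> @ [False])) + measure \<mu> (cylinder (\<sigma> @ [True]))"
      using finite_measure_Union[of "cylinder (\<sigma> @ [False])" "cylinder (\<sigma> @ [True])"]
      by (simp add: sets_\<mu> open_cylinder)
    then have "measure \<mu> (cylinder \<sigma>) * 2 ^ n = measure \<mu> (cylinder (\<sigma> @ [False])) * 2 ^ n
        + measure \<mu> (cylinder (\<sigma> @ [True])) * 2 ^ n" by (simp add: algebra_simps)
    with approx'[OF *(1)] approx'[OF *(2)] approx'[OF *(3)]
    have "real y0 + real y1 \<le> real y + 3" "real y \<le> real y0 + real y1 + 3"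
      unfolding abs_le_iff by linarith+
    then have "real (y0 + y1) \<le> real (y + 3)" "real y \<le> real (y0 + y1 + 3)" by simp_all
    then show False using *(4) unfolding of_nat_le_iff by linarith
  qed
  ultimately show ?thesis by (simp add: conflict_def)
qed

lemma le_of_le_inverse_power:
  fixes a b :: real
  assumes "\<And>n. a \<le> b + c / 2 ^ n"
  shows "a \<le> b"
proof -
  have "(\<lambda>n. b + c * (1 / 2) ^ n) \<longlonglongrightarrow> b + c * 0"
    by (intro tendsto_intros LIMSEQ_realpow_zero) auto
  moreover have "\<forall>n. a \<le> b + c * (1 / 2) ^ n" using assms by (simp add: power_one_over)
  ultimately show ?thesis using LIMSEQ_le_const[of _ "b + c * 0" a] by auto
qed

text \<open>Without \<open>approx_conflict\<close> the approximations to each cylinder are Cauchy.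
  The other two tolerances are constant numbers of units \<open>1 / 2 ^ n\<close>, so they vanish in
  the limit, which is thus normalised and additive.\<close>

lemma no_conflict_imp_computes_measure:
  assumes total: "\<And>\<sigma> n. phi e (prod_encode (string_encode \<sigma>, n)) \<noteq> None" and no_conflict: "\<And>w. \<not> conflict e w"
  shows "\<exists>\<mu>. computes_measure (phi e) \<mu>"
proof -
  define y where "y \<sigma> n = the (phi e (prod_encode (string_encode \<sigma>, n)))" for \<sigma> n
  have y: "phi e (prod_encode (string_encode \<sigma>, n)) = Some (y \<sigma> n)" for \<sigma> n
    using total unfolding y_def by simp
  define q where "q \<sigma> n = real (y \<sigma> n) / 2 ^ n" for \<sigma> n
  have q_le: "q \<sigma> n \<le> q \<sigma> n' + (1 / 2 ^ n + 1 / 2 ^ n')" for \<sigma> n n'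
  proof -
    have "y \<sigma> n * 2 ^ n' \<le> y \<sigma> n' * 2 ^ n + 2 ^ n + 2 ^ n'"
      using no_conflict approx_conflict_iff[of e] y[of \<sigma> n] y[of \<sigma> n'] unfolding conflict_def
      by (blast intro: leI)
    then have "real (y \<sigma> n * 2 ^ n') \<le> real (y \<sigma> n' * 2 ^ n + 2 ^ n + 2 ^ n')"
      by (simp only: of_nat_le_iff)
    then show ?thesis by (simp add: q_def field_simps)
  qed
  have q_dist: "\<bar>q \<sigma> n - q \<sigma> n'\<bar> \<le> 1 / 2 ^ n + 1 / 2 ^ n'" for \<sigma> n n'
    using q_le[of \<sigma> n n'] q_le[of \<sigma> n' n] by linarith
  have "Cauchy (q \<sigma>)" for \<sigma>
  proof (rule metric_CauchyI)
    fix \<epsilon> :: real assume "0 < \<epsilon>"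
    then obtain N where N: "(1 / 2) ^ N < \<epsilon> / 2"
      using real_arch_pow_inv[of "\<epsilon> / 2" "1 / 2"] by auto
    have "dist (q \<sigma> n) (q \<sigma> n') < \<epsilon>" if "n \<ge> N" "n' \<ge> N" for n n'
    proof -
      have "1 / 2 ^ k \<le> (1 / 2 :: real) ^ N" if "k \<ge> N" for k
        unfolding power_one_over[symmetric] using that by (intro power_decreasing) auto
      from this[OF that(1)] this[OF that(2)] show ?thesis
        using q_dist[of \<sigma> n n'] N by (simp add: dist_real_def)
    qed
    then show "\<exists>N. \<forall>n\<ge>N. \<forall>n'\<ge>N. dist (q \<sigma> n) (q \<sigma> n') < \<epsilon>" by blast
  qed
  then obtain m where m: "q \<sigma> \<longlonglongrightarrow> m \<sigma>" for \<sigma>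
    unfolding Cauchy_convergent_iff convergent_def by metis
  \<comment> \<open>Letting only \<open>n'\<close> grow removes the second error term, so
    \<open>phi e\<close> itself meets the required precision for the limit.\<close>
  have m_q: "\<bar>m \<sigma> - q \<sigma> n\<bar> \<le> 1 / 2 ^ n" for \<sigma> n
  proof -
    have "(\<lambda>n'. \<bar>q \<sigma> n' - q \<sigma> n\<bar>) \<longlonglongrightarrow> \<bar>m \<sigma> - q \<sigma> n\<bar>"
      by (intro tendsto_intros m)
    moreover have "(\<lambda>n'. 1 / 2 ^ n + (1 / 2) ^ n' :: real) \<longlonglongrightarrow> 1 / 2 ^ n + 0"
      by (intro tendsto_intros LIMSEQ_realpow_zero) auto
    moreover have "\<bar>q \<sigma> n' - q \<sigma> n\<bar> \<le> 1 / 2 ^ n + (1 / 2) ^ n'" for n'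
      using q_dist[of \<sigma> n' n] by (simp add: power_one_over)
    ultimately show ?thesis using LIMSEQ_le by fastforce
  qed
  have m_y: "\<bar>m \<sigma> * 2 ^ n - real (y \<sigma> n)\<bar> \<le> 1" for \<sigma> n
  proof -
    have "m \<sigma> * 2 ^ n - real (y \<sigma> n) = (m \<sigma> - q \<sigma> n) * 2 ^ n"
      by (simp add: q_def left_diff_distrib)
    then have "\<bar>m \<sigma> * 2 ^ n - real (y \<sigma> n)\<bar> = \<bar>m \<sigma> - q \<sigma> n\<bar> * 2 ^ n"
      by (simp only: abs_mult) simp
    also have "\<dots> \<le> 1 / 2 ^ n * 2 ^ n" by (intro mult_right_mono m_q) simp
    finally show ?thesis by simp
  qed
  have "0 \<le> m \<sigma>" for \<sigma>
    by (rule LIMSEQ_le_const[OF m]) (simp add: q_def)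
  moreover have "m [] = 1"
  proof (rule antisym)
    have y_Nil: "\<bar>2 ^ n - real (y [] n)\<bar> \<le> 1" for n
    proof -
      have "y [] n \<le> 2 ^ n + 1" "2 ^ n \<le> y [] n + 1"
        using no_conflict mass_conflict_iff[of e] y[of "[]" n] unfolding conflict_def
        by (blast intro: leI)+
      then have "real (y [] n) \<le> real (2 ^ n + 1)" "real (2 ^ n) \<le> real (y [] n + 1)"
        by (simp_all only: of_nat_le_iff)
      then show ?thesis by auto
    qed
    have *: "\<bar>m [] * 2 ^ n - 2 ^ n\<bar> \<le> 2" for n using m_y[of "[]" n] y_Nil[of n] by linarith
    have le: "m [] \<le> 1 + 2 / 2 ^ n" "1 \<le> m [] + 2 / 2 ^ n" for n
      using *[of n] by (auto simp: field_simps)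
    show "m [] \<le> 1" "1 \<le> m []"
      by (rule le_of_le_inverse_power[OF le(1)] le_of_le_inverse_power[OF le(2)])+
  qed
  moreover have "m \<sigma> = m (\<sigma> @ [False]) + m (\<sigma> @ [True])" for \<sigma>
  proof (rule antisym)
    let ?F = "\<sigma> @ [False]" and ?T = "\<sigma> @ [True]"
    have y_snoc: "\<bar>real (y ?F n) + real (y ?T n) - real (y \<sigma> n)\<bar> \<le> 3" for n
    proof -
      have "y ?F n + y ?T n \<le> y \<sigma> n + 3" "y \<sigma> n \<le> y ?F n + y ?T n + 3"
        using no_conflict additivity_conflict_iff[of e] y[of \<sigma> n] y[of ?F n] y[of ?T n]
        unfolding conflict_def by (blast intro: leI)+
      then have "real (y ?F n + y ?T n) \<le> real (y \<sigma> n + 3)"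
        "real (y \<sigma> n) \<le> real (y ?F n + y ?T n + 3)"
        by (simp_all only: of_nat_le_iff)
      then show ?thesis by auto
    qed
    \<comment> \<open>Three errors of approximation plus the tolerance 3 of
      \<open>additivity_conflict\<close>.\<close>
    have *: "\<bar>m ?F * 2 ^ n + m ?T * 2 ^ n - m \<sigma> * 2 ^ n\<bar> \<le> 6" for n
      using m_y[of ?F n] m_y[of ?T n] m_y[of \<sigma> n] y_snoc[of n] by linarith
    have le: "m \<sigma> \<le> m ?F + m ?T + 6 / 2 ^ n" "m ?F + m ?T \<le> m \<sigma> + 6 / 2 ^ n" for n
      using *[of n] by (auto simp: field_simps)
    show "m \<sigma> \<le> m ?F + m ?T" "m ?F + m ?T \<le> m \<sigma>"
      by (rule le_of_le_inverse_power[OF le(1)] le_of_le_inverse_power[OF le(2)])+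
  qed
  ultimately obtain \<mu> where \<mu>: "cantor_measure \<mu>" "\<And>\<sigma>. measure \<mu> (cylinder \<sigma>) = m \<sigma>"
    using cantor_measure_exists[of m] by blast
  then have "computes_measure (phi e) \<mu>"
    unfolding computes_measure_def \<mu>(2) using y m_q[unfolded q_def] by blast
  then show ?thesis by blast
qed


section \<open>The universal test characterises randomness\<close>

lemma bitseq_cylinders_disjoint:
  "disjoint_family_on (\<lambda>r. cylinder (initial_segment (bitseq r) n)) {..<2 ^ n}"
  unfolding disjoint_family_on_def
proof (intro ballI impI, rule ccontr)
  fix r r' assume *: "r \<in> {..<2 ^ n}" "r' \<in> {..<2 ^ n}" "r \<noteq> r'"
    and "cylinder (initial_segment (bitseq r) n) \<inter> cylinder (initial_segment (bitseq r') n) \<noteq> {}"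
  then obtain X where "\<forall>i<n. X i = bitseq r i" "\<forall>i<n. X i = bitseq r' i"
    by (auto simp: cylinder_initial_segment)
  then have "\<forall>i<n. bitseq r i = bitseq r' i" by simp
  with * bitseq_inject show False by auto
qed

text \<open>The \<open>2 ^ n\<close> cylinders of strings of length \<open>n\<close> partition the
  space, and \<open>D\<close> is constant on each.\<close>

lemma measure_finitely_determined:
  assumes \<mu>: "cantor_measure \<mu>"
    and D: "\<And>X Y. \<forall>i<n. X i = Y i \<Longrightarrow> D X \<longleftrightarrow> D Y"
  shows "{X. D X} \<in> sets \<mu>"
    and "measure \<mu> {X. D X} =
      (\<Sum>r<2 ^ n. if D (bitseq r) then measure \<mu> (cylinder (initial_segment (bitseq r) n)) else 0)"
proof -
  interpret prob_space \<mu> using \<mu> by (simp add: cantor_measure_def)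
  have sets_\<mu>: "sets \<mu> = sets borel" using \<mu> by (simp add: cantor_measure_def)
  let ?C = "\<lambda>r. cylinder (initial_segment (bitseq r) n)"
  let ?I = "{r \<in> {..<2 ^ n}. D (bitseq r)}"
  have eq: "{X. D X} = (\<Union>r\<in>?I. ?C r)"
  proof (intro equalityI subsetI)
    fix X assume X: "X \<in> {X. D X}"
    obtain r where r: "r < 2 ^ n" "\<forall>i<n. bitseq r i = X i" using bitseq_surj by blast
    then have "D (bitseq r)" "X \<in> ?C r"
      using D[of "bitseq r" X] X by (simp_all add: cylinder_initial_segment)
    then show "X \<in> (\<Union>r\<in>?I. ?C r)" using r(1) by blast
  next
    fix X assume "X \<in> (\<Union>r\<in>?I. ?C r)"
    then obtain r where r: "D (bitseq r)" "\<forall>i<n. X i = bitseq r i"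
      by (auto simp: cylinder_initial_segment)
    show "X \<in> {X. D X}" using D[OF r(2)] r(1) by simp
  qed
  have C: "?C r \<in> sets \<mu>" for r by (simp add: sets_\<mu> open_cylinder)
  show "{X. D X} \<in> sets \<mu>" unfolding eq by (intro sets.finite_UN C) simp
  have "measure \<mu> {X. D X} = (\<Sum>r\<in>?I. measure \<mu> (?C r))"
    unfolding eq
    by (intro finite_measure_finite_Union disjoint_family_on_mono[OF _ bitseq_cylinders_disjoint])
      (auto simp: C)
  also have "\<dots> = (\<Sum>r<2 ^ n. if D (bitseq r) then measure \<mu> (?C r) else 0)"
    by (rule sum.inter_filter) simp
  finally show "measure \<mu> {X. D X} = \<dots>" .
qed

text \<open>A union of finitely many nested sets is its largest member; continuity from below does
  the rest. It bounds all stages of one test that look small by the bound for a single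
  stage.\<close>

lemma (in finite_measure) measure_Union_incseq_le:
  fixes A :: "nat \<Rightarrow> 'a set"
  assumes A: "\<And>s. A s \<in> sets M" and mono: "\<And>s t. s \<le> t \<Longrightarrow> A s \<subseteq> A t"
    and le: "\<And>s. s \<in> S \<Longrightarrow> measure M (A s) \<le> b" and "0 \<le> b"
  shows "measure M (\<Union>s\<in>S. A s) \<le> b"
proof -
  define B where "B n = (\<Union>s\<in>S \<inter> {..n}. A s)" for n
  have "measure M (B n) \<le> b" for n
  proof (cases "S \<inter> {..n} = {}")
    case True
    then show ?thesis using \<open>0 \<le> b\<close> by (simp add: B_def)
  next
    case False
    let ?t = "Max (S \<inter> {..n})"
    have t: "?t \<in> S \<inter> {..n}" using False by (intro Max_in) auto
    have "B n = A ?t"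
    proof (rule antisym)
      show "B n \<subseteq> A ?t" unfolding B_def by (intro UN_least mono Max_ge) auto
      show "A ?t \<subseteq> B n" unfolding B_def using t by blast
    qed
    then show ?thesis using le t by simp
  qed
  moreover have "(\<lambda>n. measure M (B n)) \<longlonglongrightarrow> measure M (\<Union>n. B n)"
  proof (rule finite_Lim_measure_incseq)
    show "range B \<subseteq> sets M" unfolding B_def using A by blast
    show "incseq B" unfolding B_def incseq_def by (intro allI impI UN_mono) auto
  qed
  moreover have "(\<Union>n. B n) = (\<Union>s\<in>S. A s)" unfolding B_def by blast
  ultimately show ?thesis using LIMSEQ_le_const2 by fastforce
qed

lemma halted_mono: "halted s e x \<Longrightarrow> s \<le> t \<Longrightarrow> halted t e x"
  unfolding halted_iff using computed_by_mono by blast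

lemma enumerated_mono: "enumerated s a m z \<Longrightarrow> s \<le> t \<Longrightarrow> enumerated t a m z"
  unfolding enumerated_def using halted_mono by force

text \<open>An enumerated code is below \<open>s\<close>, and the code of a segment is at least its
  length.\<close>

lemma stage_covers_iff: "stage_covers s a m X \<longleftrightarrow> (\<exists>k. enumerated s a m (seg X k))"
  unfolding stage_covers_def enumerated_def using seg_ge le_less_trans by blast

lemma stage_covers_cong:
  assumes "\<forall>i<s. X i = Y i"
  shows "stage_covers s a m X \<longleftrightarrow> stage_covers s a m Y"
proof -
  have "initial_segment X k = initial_segment Y k" if "k < s" for k
    using assms that by (simp add: initial_segment_eq_iff)
  then show ?thesis unfolding stage_covers_def by auto
qed

lemma stage_approximation:
  assumes \<mu>: "computes_measure (phi e) \<mu>"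
    and halted: "\<forall>r<2 ^ s. halted w e (prod_encode (seg (bitseq r) s, s + m))"
  shows "\<bar>measure \<mu> {X. stage_covers s a m X} * 2 ^ (s + m) -
    real (stage_sum w e s a m)\<bar> \<le> 2 ^ s"
proof -
  let ?c = "\<lambda>r. stage_covers s a m (bitseq r)"
  let ?p = "\<lambda>r. measure \<mu> (cylinder (initial_segment (bitseq r) s))"
  let ?o = "\<lambda>r. output_by w e (prod_encode (seg (bitseq r) s, s + m))"
  have \<mu>': "cantor_measure \<mu>" using \<mu> by (simp add: computes_measure_def)
  have err: "\<bar>?p r * 2 ^ (s + m) - real (?o r)\<bar> \<le> 1" if "r < 2 ^ s" for r
    using computes_measure_approx[OF \<mu> output_by_eq] halted that by blast
  have "measure \<mu> {X. stage_covers s a m X} = (\<Sum>r<2 ^ s. if ?c r then ?p r else 0)"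
    by (rule measure_finitely_determined(2)[OF \<mu>' stage_covers_cong])
  then have eq: "measure \<mu> {X. stage_covers s a m X} * 2 ^ (s + m) - real (stage_sum w e s a m)
    = (\<Sum>r<2 ^ s. if ?c r then ?p r * 2 ^ (s + m) - real (?o r) else 0)"
    unfolding stage_sum_def of_nat_sum by (simp only: sum_distrib_right sum_subtractf[symmetric])
      (intro sum.cong, auto)
  have "\<bar>measure \<mu> {X. stage_covers s a m X} * 2 ^ (s + m) - real (stage_sum w e s a m)\<bar>
    \<le> (\<Sum>r<2 ^ s. \<bar>if ?c r then ?p r * 2 ^ (s + m) - real (?o r) else 0\<bar>)"
    unfolding eq by (rule sum_abs)
  also have "\<dots> \<le> (\<Sum>r<(2::nat) ^ s. 1)"
  proof (rule sum_mono)
    fix r :: nat assume "r \<in> {..<2 ^ s}"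
    then show "\<bar>if ?c r then ?p r * 2 ^ (s + m) - real (?o r) else 0\<bar> \<le> 1"
      using err[of r] by (cases "?c r") (simp_all only: if_True if_False lessThan_iff abs_zero zero_le_one)
  qed
  also have "\<dots> = 2 ^ s" by simp
  finally show ?thesis .
qed

text \<open>Threshold \<open>2 ^ Suc s\<close> plus error \<open>2 ^ s\<close> gives
  \<open>3 * 2 ^ s\<close>, in units of \<open>1 / 2 ^ (s + m)\<close>.\<close>

lemma measure_stage_le:
  assumes \<mu>: "computes_measure (phi e) \<mu>" and small: "stage_small w e s a m"
  shows "measure \<mu> {X. stage_covers s a m X} \<le> 3 / 2 ^ m"
proof -
  let ?S = "stage_sum w e s a m"
  have "?S \<le> 2 ^ Suc s" using small by (simp add: stage_small_def)
  then have "real ?S \<le> real (2 ^ Suc s)" by (simp only: of_nat_le_iff)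
  moreover have "measure \<mu> {X. stage_covers s a m X} * 2 ^ (s + m) \<le> real ?S + 2 ^ s"
    using stage_approximation[OF \<mu> small[unfolded stage_small_def, THEN conjunct1], of a] by linarith
  ultimately have "measure \<mu> {X. stage_covers s a m X} * 2 ^ (s + m) \<le> 3 * 2 ^ s" by simp
  then have "(measure \<mu> {X. stage_covers s a m X} * 2 ^ m) * 2 ^ s \<le> 3 * 2 ^ s"
    by (simp add: power_add mult.commute mult.left_commute)
  then show ?thesis by (simp add: field_simps)
qed

lemma stage_smallI:
  assumes \<mu>: "computes_measure (phi e) \<mu>"
    and le: "measure \<mu> {X. stage_covers s a m X} \<le> 1 / 2 ^ m"
    and halted: "\<forall>r<2 ^ s. halted w e (prod_encode (seg (bitseq r) s, s + m))"
  shows "stage_small w e s a m"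
proof -
  let ?S = "stage_sum w e s a m"
  have "measure \<mu> {X. stage_covers s a m X} * 2 ^ (s + m) \<le> 1 / 2 ^ m * 2 ^ (s + m)"
    by (intro mult_right_mono le) simp
  also have "\<dots> = 2 ^ s" by (simp add: power_add)
  finally have "real ?S \<le> 2 ^ Suc s"
    using stage_approximation[OF \<mu> halted, of a] by simp
  then have "real ?S \<le> real (2 ^ Suc s)" by simp
  then have "?S \<le> 2 ^ Suc s" by (simp only: of_nat_le_iff)
  then show ?thesis using halted by (simp add: stage_small_def)
qed

text \<open>The strings that are hit form a Martin-Loef test for \<open>\<mu>\<close>, and a random
  \<open>X\<close> escapes one of its levels.\<close>

lemma ml_random_imp_no_hit:
  assumes \<mu>: "computes_measure (phi e) \<mu>" and X: "ml_random \<mu> X"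
  shows "\<exists>c. \<forall>k w. \<not> hit e c (seg X k) w"
proof -
  have \<mu>': "cantor_measure \<mu>" using \<mu> by (simp add: computes_measure_def)
  interpret prob_space \<mu> using \<mu>' by (simp add: cantor_measure_def)
  define W where "W c = {\<sigma>. \<exists>w. hit e c (string_encode \<sigma>) w}" for c
  have "computably_enumerable {prod_encode (c, string_encode \<sigma>) | c \<sigma>. \<sigma> \<in> W c}"
  proof -
    \<comment> \<open>A number that codes no string can also be hit; the extra components of the
      witness \<open>w\<close> certify that \<open>psnd x\<close> is a string code.\<close>
    let ?R = "\<lambda>x w. psnd x = seg (bitseq (pfst w)) (pfst (psnd w)) \<and> hit e (pfst x) (psnd x) (psnd (psnd w))"
    have "decidable (\<lambda>z. ?R (pfst z) (psnd z))"
      by (intro recursive_intros dec_hit tr_seg)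
    then have "computably_enumerable {x. \<exists>w. ?R x w}" by (rule ce_projection)
    also have "{x. \<exists>w. ?R x w} = {prod_encode (c, string_encode \<sigma>) | c \<sigma>. \<sigma> \<in> W c}"
    proof (intro equalityI subsetI)
      fix x assume "x \<in> {x. \<exists>w. ?R x w}"
      then obtain w where w: "?R x w" by blast
      let ?\<sigma> = "initial_segment (bitseq (pfst w)) (pfst (psnd w))"
      have "x = prod_encode (pfst x, string_encode ?\<sigma>)" using prod_encode_collapse[of x] w by simp
      moreover have "?\<sigma> \<in> W (pfst x)" unfolding W_def using w by auto
      ultimately show "x \<in> {prod_encode (c, string_encode \<sigma>) | c \<sigma>. \<sigma> \<in> W c}" by blast
    next
      fix x assume "x \<in> {prod_encode (c, string_encode \<sigma>) | c \<sigma>. \<sigma> \<in> W c}"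
      then obtain c \<sigma> w where x: "x = prod_encode (c, string_encode \<sigma>)" "hit e c (string_encode \<sigma>) w"
        unfolding W_def by blast
      obtain r where "initial_segment (bitseq r) (length \<sigma>) = \<sigma>" using string_eq_bitseq by blast
      then have "?R x (prod_encode (r, prod_encode (length \<sigma>, w)))" using x by simp
      then show "x \<in> {x. \<exists>w. ?R x w}" by blast
    qed
    finally show ?thesis .
  qed
  moreover have "measure \<mu> (open_of (W c)) \<le> 1 / 2 ^ c" for c
  proof -
    define A where "A a s = {X. stage_covers s a (a + c + 3) X}" for a s
    define U where "U a = (\<Union>s\<in>{s. \<exists>w. stage_small w e s a (a + c + 3)}. A a s)" for a
    have A_sets: "A a s \<in> sets \<mu>" for a s
      unfolding A_def by (rule measure_finitely_determined(1)[OF \<mu>' stage_covers_cong])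
    \<comment> \<open>The 8 is \<open>2 ^ 3\<close>: summing over \<open>a\<close> doubles the
      bound, and the shift of levels by 3 brings the total \<open>3 / 4 * (1 / 2) ^ c\<close> below
      \<open>1 / 2 ^ c\<close>.\<close>
    have U_le: "measure \<mu> (U a) \<le> 3 / 8 * (1 / 2) ^ c * (1 / 2) ^ a" for a
    proof -
      have "measure \<mu> (U a) \<le> 3 / 2 ^ (a + c + 3)"
        unfolding U_def
      proof (rule measure_Union_incseq_le[OF A_sets])
        show "A a s \<subseteq> A a t" if "s \<le> t" for s t
          unfolding A_def stage_covers_iff using enumerated_mono[OF _ that] by blast
      qed (auto simp: A_def intro: measure_stage_le[OF \<mu>])
      also have "\<dots> = 3 / 8 * (1 / 2) ^ c * (1 / 2) ^ a" by (simp add: power_add power_one_over)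
      finally show ?thesis .
    qed
    have U_sets: "range U \<subseteq> sets \<mu>" unfolding U_def using A_sets by blast
    have sums: "(\<lambda>a. 3 / 8 * (1 / 2) ^ c * (1 / 2) ^ a :: real) sums (3 / 8 * (1 / 2) ^ c * 2)"
      using geometric_sums[of "1 / 2 :: real"] by (intro sums_mult) simp
    then have summable: "summable (\<lambda>a. measure \<mu> (U a))"
      using U_le by (intro summable_comparison_test[OF _ sums_summable[OF sums]]) auto
    have "open_of (W c) \<subseteq> (\<Union>a. U a)"
    proof
      fix Y assume "Y \<in> open_of (W c)"
      then obtain \<sigma> w where \<sigma>: "hit e c (string_encode \<sigma>) w" "Y \<in> cylinder \<sigma>"
        unfolding open_of_def W_def by blast
      then have \<sigma>_eq: "string_encode \<sigma> = seg Y (length \<sigma>)" by (simp add: cylinder_def)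
      obtain s a where "enumerated s a (a + c + 3) (string_encode \<sigma>)"
        and small: "stage_small w e s a (a + c + 3)" using \<sigma>(1) unfolding hit_def by blast
      then have "Y \<in> A a s" unfolding A_def stage_covers_iff \<sigma>_eq by blast
      then show "Y \<in> (\<Union>a. U a)" unfolding U_def using small by blast
    qed
    then have "measure \<mu> (open_of (W c)) \<le> measure \<mu> (\<Union>a. U a)"
      using U_sets by (intro finite_measure_mono) auto
    also have "\<dots> \<le> (\<Sum>a. measure \<mu> (U a))"
      by (rule finite_measure_subadditive_countably[OF U_sets summable])
    also have "\<dots> \<le> 3 / 8 * (1 / 2) ^ c * 2"
      using suminf_le[OF U_le summable sums_summable[OF sums]] sums_unique[OF sums] by simp
    also have "\<dots> = 3 / 4 * (1 / 2) ^ c" by simp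
    also have "\<dots> \<le> 1 * (1 / 2) ^ c" by (intro mult_right_mono) simp_all
    also have "\<dots> = 1 / 2 ^ c" by (simp add: power_one_over)
    finally show ?thesis .
  qed
  ultimately have "ml_test \<mu> W" unfolding ml_test_def by (intro conjI allI)
  then have "X \<notin> (\<Inter>c. open_of (W c))" using X unfolding ml_random_def by blast
  then obtain c where c: "X \<notin> open_of (W c)" by blast
  have "\<not> hit e c (seg X k) w" for k w
  proof
    assume "hit e c (seg X k) w"
    then have "initial_segment X k \<in> W c" unfolding W_def by blast
    moreover have "X \<in> cylinder (initial_segment X k)" by (simp add: cylinder_initial_segment)
    ultimately show False using c unfolding open_of_def by blast
  qed
  then show ?thesis by blast
qed

text \<open>Universality: a test capturing \<open>X\<close> is the domain of some
  \<open>phi a\<close>, and a stage of its level \<open>a + c + 3\<close> covers \<open>X\<close>.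
  Being part of that level, the stage has measure at most \<open>1 / 2 ^ (a + c + 3)\<close>, so it
  passes as small once \<open>phi e\<close> has delivered the finitely many approximations.\<close>

lemma no_hit_imp_ml_random:
  assumes \<mu>: "computes_measure (phi e) \<mu>" and no_hit: "\<And>k w. \<not> hit e c (seg X k) w"
  shows "ml_random \<mu> X"
  unfolding ml_random_def
proof (intro allI impI notI)
  fix W assume W: "ml_test \<mu> W" and X: "X \<in> (\<Inter>m. open_of (W m))"
  interpret prob_space \<mu> using \<mu> by (simp add: computes_measure_def cantor_measure_def)
  have sets_\<mu>: "sets \<mu> = sets borel" using \<mu> by (simp add: computes_measure_def cantor_measure_def)
  obtain a where a: "dom (phi a) = {prod_encode (m, string_encode \<sigma>) | m \<sigma>. \<sigma> \<in> W m}"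
    using W unfolding ml_test_def computably_enumerable_def partial_recursive_def by blast
  have in_W: "\<sigma> \<in> W m \<longleftrightarrow> phi a (prod_encode (m, string_encode \<sigma>)) \<noteq> None" for \<sigma> m
  proof -
    have "phi a (prod_encode (m, string_encode \<sigma>)) \<noteq> None \<longleftrightarrow>
      prod_encode (m, string_encode \<sigma>) \<in> {prod_encode (m, string_encode \<sigma>) | m \<sigma>. \<sigma> \<in> W m}"
      unfolding a[symmetric] by (simp add: dom_def)
    then show ?thesis by (auto simp: string_encode_inject)
  qed
  let ?m = "a + c + 3"
  have "X \<in> open_of (W ?m)" using X by blast
  then obtain \<sigma> where "\<sigma> \<in> W ?m" "X \<in> cylinder \<sigma>" unfolding open_of_def by blast
  then have k: "initial_segment X (length \<sigma>) \<in> W ?m" (is "initial_segment X ?k \<in> _")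
    by (simp add: cylinder_def)
  then have "\<forall>\<^sub>F s in sequentially. halted s a (prod_encode (?m, seg X ?k))"
    using in_W eventually_halted by blast
  then have "\<forall>\<^sub>F s in sequentially. enumerated s a ?m (seg X ?k)"
    using eventually_gt_at_top[of "seg X ?k"] unfolding enumerated_def by eventually_elim simp
  then obtain s where s: "enumerated s a ?m (seg X ?k)"
    unfolding eventually_sequentially by blast
  have "{Y. stage_covers s a ?m Y} \<subseteq> open_of (W ?m)"
  proof
    fix Y assume "Y \<in> {Y. stage_covers s a ?m Y}"
    then obtain j where "enumerated s a ?m (seg Y j)" unfolding stage_covers_iff by blast
    then have "initial_segment Y j \<in> W ?m" unfolding in_W enumerated_def using halted_imp by blast
    moreover have "Y \<in> cylinder (initial_segment Y j)" by (simp add: cylinder_initial_segment)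
    ultimately show "Y \<in> open_of (W ?m)" unfolding open_of_def by blast
  qed
  moreover have "open (open_of (W ?m))" unfolding open_of_def by (intro open_UN ballI open_cylinder)
  then have "open_of (W ?m) \<in> sets \<mu>" by (simp add: sets_\<mu>)
  ultimately have "measure \<mu> {Y. stage_covers s a ?m Y} \<le> measure \<mu> (open_of (W ?m))"
    by (intro finite_measure_mono)
  also have "\<dots> \<le> 1 / 2 ^ ?m" using W unfolding ml_test_def by blast
  finally have le: "measure \<mu> {Y. stage_covers s a ?m Y} \<le> 1 / 2 ^ ?m" .
  have "phi e (prod_encode (string_encode \<tau>, n)) \<noteq> None" for \<tau> n
    using \<mu> unfolding computes_measure_def by fastforce
  then have "\<forall>\<^sub>F w in sequentially. \<forall>r\<in>{..<2 ^ s}. halted w e (prod_encode (seg (bitseq r) s, s + ?m))"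
    by (intro eventually_ball_finite ballI eventually_halted) simp_all
  then have "\<forall>\<^sub>F w in sequentially. hit e c (seg X ?k) w"
    using eventually_gt_at_top[of s] eventually_gt_at_top[of a]
  proof eventually_elim
    case (elim w)
    have "stage_small w e s a ?m" by (rule stage_smallI[OF \<mu> le]) (use elim(1) in simp)
    then show ?case unfolding hit_def using elim(2,3) s by blast
  qed
  then show False using no_hit unfolding eventually_sequentially by blast
qed


section \<open>The learner\<close>

text \<open>
  The second component of \<^const>\<open>CPrec\<close> is never run when the recursion argument is \<open>0\<close>, so its code
  can be an arbitrary number \<open>k\<close>.
\<close>

definition pad :: "nat \<Rightarrow> nat \<Rightarrow> nat" where
  "pad e k = 5 + 4 * prod_encode (6 + 4 * prod_encode (e, k), goedel (CPair (CPair CFst CSnd) CZero))"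

lemma phi_pad: "phi (pad e k) = phi e"
proof
  fix x
  let ?g = "goedel (CPair (CPair CFst CSnd) CZero)"
  have "phi ?g x = Some (prod_encode (x, 0))" by (simp only: phi_def inv_goedel) simp
  then show "phi (pad e k) x = phi e x"
    unfolding pad_def phi_CComp by (simp del: goedel.simps add: phi_CPrec_0)
qed

lemma mu_pad: "mu (pad e k) = mu e"
  by (simp add: mu_def phi_pad)

lemma pad_inject: "pad e k = pad e' k' \<longleftrightarrow> e = e' \<and> k = k'"
  by (simp add: pad_def prod_encode_eq del: goedel.simps)

lemma tr_pad: "total_recursive a \<Longrightarrow> total_recursive b \<Longrightarrow> total_recursive (\<lambda>z. pad (a z) (b z))"
  unfolding pad_def by (intro recursive_intros)

definition refuted :: "nat \<Rightarrow> nat \<Rightarrow> (nat \<Rightarrow> bool) \<Rightarrow> nat \<Rightarrow> bool" where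
  "refuted e c X w \<longleftrightarrow> conflict e w \<or> (\<exists>k<w. hit e c (seg X k) w)"

text \<open>A finite part of the forall-exists statement: \<open>l\<close> bounds what is checked,
  \<open>t\<close> is the time granted to \<open>phi\<close> for halting.\<close>

definition verified :: "nat \<Rightarrow> (nat \<Rightarrow> bool) \<Rightarrow> nat \<Rightarrow> nat \<Rightarrow> bool" where
  "verified i X l t \<longleftrightarrow>
     (\<forall>k<l. \<forall>r<l. \<forall>n<l. halted t (pfst i) (prod_encode (seg (bitseq r) k, n))) \<and>
     (\<forall>w<l. \<not> refuted (pfst i) (psnd i) X w)"

text \<open>
  A stage codes a triple \<open>(i, l, t)\<close>; demanding that \<open>t\<close> is least makes each \<open>l\<close> contribute at most
  one active stage.
\<close>

definition active :: "(nat \<Rightarrow> bool) \<Rightarrow> nat \<Rightarrow> bool" where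
  "active X n \<longleftrightarrow> verified (pfst n) X (pfst (psnd n)) (psnd (psnd n)) \<and>
     (\<forall>t<psnd (psnd n). \<not> verified (pfst n) X (pfst (psnd n)) t)"

text \<open>In the language of priority arguments, an activity of a smaller pair injures
  \<open>i\<close>.\<close>

definition injury_count :: "(nat \<Rightarrow> bool) \<Rightarrow> nat \<Rightarrow> nat \<Rightarrow> nat" where
  "injury_count X i n = (\<Sum>n'<n. of_bool (pfst n' < i \<and> active X n'))"

text \<open>
  An inactive stage outputs its own number, so every value arises at most once in this way.
\<close>

definition guess :: "(nat \<Rightarrow> bool) \<Rightarrow> nat \<Rightarrow> nat" where
  "guess X n = (if active X n
     then pad (pfst (pfst n)) (prod_encode (pfst n, injury_count X (pfst n) n)) else n)"

text \<open>The string is continued by \<open>False\<close>; by \<open>guess_cong\<close> the stage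
  given by its length does not read that far.\<close>

definition learner :: "bool list \<Rightarrow> nat" where
  "learner \<sigma> = guess (\<lambda>i. i < length \<sigma> \<and> \<sigma> ! i) (length \<sigma>)"

lemma pfst_le: "pfst n \<le> n"
  using le_prod_encode_1[of "pfst n" "psnd n"] by simp

lemma psnd_le: "psnd n \<le> n"
  using le_prod_encode_2[of "psnd n" "pfst n"] by simp

lemma refuted_cong:
  assumes "\<forall>i<w. X i = Y i"
  shows "refuted e c X w \<longleftrightarrow> refuted e c Y w"
proof -
  have "initial_segment X k = initial_segment Y k" if "k < w" for k
    using assms that by (simp add: initial_segment_eq_iff)
  then show ?thesis unfolding refuted_def by auto
qed

text \<open>The bound \<open>l\<close> is a component of the code \<open>n\<close>, hence at most
  \<open>n\<close>, and the checks read fewer than \<open>l\<close> bits.\<close>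

lemma active_cong:
  assumes "\<forall>i<n. X i = Y i"
  shows "active X n \<longleftrightarrow> active Y n"
proof -
  have l: "pfst (psnd n) \<le> n" using pfst_le psnd_le le_trans by blast
  have "refuted e c X w \<longleftrightarrow> refuted e c Y w" if "w < pfst (psnd n)" for e c w
    using assms that l by (intro refuted_cong) simp
  then have "verified i X (pfst (psnd n)) t \<longleftrightarrow> verified i Y (pfst (psnd n)) t" for i t
    unfolding verified_def by simp
  then show ?thesis unfolding active_def by simp
qed

lemma guess_cong:
  assumes "\<forall>i<n. X i = Y i"
  shows "guess X n = guess Y n"
proof -
  have "active X m \<longleftrightarrow> active Y m" if "m \<le> n" for m
    using assms that by (intro active_cong) simp
  then show ?thesis unfolding guess_def injury_count_def by simp
qed

lemma learner_initial_segment: "learner (initial_segment X n) = guess X n"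
  unfolding learner_def length_initial_segment
  by (rule guess_cong) (simp add: initial_segment_def)

lemma dec_active:
  assumes "total_recursive r" "total_recursive n"
  shows "decidable (\<lambda>z. active (bitseq (r z)) (n z))"
proof -
  have "decidable (\<lambda>z. refuted (pfst z) (pfst (psnd z)) (bitseq (pfst (psnd (psnd z)))) (psnd (psnd (psnd z))))"
    unfolding refuted_def by (intro recursive_intros dec_conflict dec_hit tr_seg)
  from dec_comp[OF this, of "\<lambda>z. prod_encode (e z, prod_encode (c z, prod_encode (r z, w z)))" for e c r w]
  have refuted: "decidable (\<lambda>z. refuted (e z) (c z) (bitseq (r z)) (w z))"
    if "total_recursive e" "total_recursive c" "total_recursive r" "total_recursive w" for e c r w
    by (simp add: tr_pair that)
  have "decidable (\<lambda>z. verified (pfst z) (bitseq (pfst (psnd z))) (pfst (psnd (psnd z))) (psnd (psnd (psnd z))))"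
    unfolding verified_def by (intro recursive_intros dec_halted tr_seg refuted)
  from dec_comp[OF this, of "\<lambda>z. prod_encode (i z, prod_encode (r z, prod_encode (l z, t z)))" for i r l t]
  have verified: "decidable (\<lambda>z. verified (i z) (bitseq (r z)) (l z) (t z))"
    if "total_recursive i" "total_recursive r" "total_recursive l" "total_recursive t" for i r l t
    by (simp add: tr_pair that)
  have "decidable (\<lambda>z. active (bitseq (pfst z)) (psnd z))"
    unfolding active_def by (intro recursive_intros verified)
  from dec_comp[OF this tr_pair[OF assms]] show ?thesis by simp
qed

lemma tr_guess: "total_recursive (\<lambda>z. guess (bitseq (pfst z)) (psnd z))"
  unfolding guess_def injury_count_def by (intro recursive_intros tr_pad dec_active)

text \<open>A string code is decoded by searching for a pair \<open>(r, k)\<close> whose segment has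
  that code; every such pair gives the same guess.\<close>

lemma computable_learner: "computable_on_strings learner"
proof -
  define R where "R x p \<longleftrightarrow> seg (bitseq (pfst p)) (psnd p) = x" for x p
  have "decidable (\<lambda>z. R (pfst z) (psnd z))" unfolding R_def by (intro recursive_intros tr_seg)
  from search_code[of R, OF this] obtain c
    where c: "\<forall>x. eval c x = (if \<exists>p. R x p then Some (LEAST p. R x p) else None)" by (rule exE)
  obtain d where d: "\<forall>p. eval d p = Some (guess (bitseq (pfst p)) (psnd p))"
    using tr_guess unfolding total_recursive_def by (rule exE)
  have "eval (CComp d c) (string_encode \<sigma>) = Some (learner \<sigma>)" for \<sigma>
  proof -
    let ?p = "LEAST p. R (string_encode \<sigma>) p"
    obtain r where "initial_segment (bitseq r) (length \<sigma>) = \<sigma>" using string_eq_bitseq by blast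
    then have R: "R (string_encode \<sigma>) (prod_encode (r, length \<sigma>))" by (simp add: R_def)
    then have "R (string_encode \<sigma>) ?p" by (rule LeastI)
    then have "initial_segment (bitseq (pfst ?p)) (psnd ?p) = \<sigma>"
      by (simp only: R_def string_encode_inject)
    then have "learner \<sigma> = guess (bitseq (pfst ?p)) (psnd ?p)"
      using learner_initial_segment[of "bitseq (pfst ?p)" "psnd ?p"] by simp
    moreover have "eval c (string_encode \<sigma>) = Some ?p" using c R by auto
    ultimately show ?thesis using d by simp
  qed
  then show ?thesis
    unfolding computable_on_strings_def using partial_recursive_eval by blast
qed

section \<open>Infinitely many active stages\<close>

lemma verified_antimono: "verified i X l' t \<Longrightarrow> l \<le> l' \<Longrightarrow> verified i X l t"
  unfolding verified_def by simp

text \<open>If some \<open>l\<close> is never verified, antimonotonicity leaves only smaller bounds,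
  each with at most one active stage.\<close>

lemma infinite_active_iff:
  "infinite {n. active X n \<and> pfst n = i} \<longleftrightarrow> (\<forall>l. \<exists>t. verified i X l t)"
proof
  let ?A = "{n. active X n \<and> pfst n = i}"
  assume inf: "infinite ?A"
  show "\<forall>l. \<exists>t. verified i X l t"
  proof (rule ccontr)
    assume "\<not> (\<forall>l. \<exists>t. verified i X l t)"
    then obtain l where l: "\<And>t. \<not> verified i X l t" by blast
    have "inj_on (\<lambda>n. pfst (psnd n)) ?A"
    proof (rule inj_onI)
      fix n n' assume n: "n \<in> ?A" "n' \<in> ?A" and eq: "pfst (psnd n) = pfst (psnd n')"
      have "\<not> psnd (psnd n) < psnd (psnd n')" "\<not> psnd (psnd n') < psnd (psnd n)"
        using n eq unfolding active_def by auto
      then have "psnd (psnd n) = psnd (psnd n')" by simp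
      then have "psnd n = psnd n'"
        using eq prod_encode_collapse[of "psnd n"] prod_encode_collapse[of "psnd n'"] by simp
      then show "n = n'"
        using n prod_encode_collapse[of n] prod_encode_collapse[of n'] by simp
    qed
    moreover have "(\<lambda>n. pfst (psnd n)) ` ?A \<subseteq> {..<l}"
    proof
      fix m assume "m \<in> (\<lambda>n. pfst (psnd n)) ` ?A"
      then obtain t where "verified i X m t" unfolding active_def by blast
      then show "m \<in> {..<l}" using verified_antimono[of i X m t l] l by (cases "l \<le> m") auto
    qed
    ultimately have "finite ?A" by (rule inj_on_finite) simp
    then show False using inf by simp
  qed
next
  assume *: "\<forall>l. \<exists>t. verified i X l t"
  let ?n = "\<lambda>l. prod_encode (i, prod_encode (l, LEAST t. verified i X l t))"
  have "inj ?n" by (rule injI) (simp add: prod_encode_eq)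
  then have "infinite (range ?n)" by (rule range_inj_infinite)
  moreover have "range ?n \<subseteq> {n. active X n \<and> pfst n = i}"
    using LeastI_ex[OF *[rule_format]] by (auto simp: active_def dest: not_less_Least)
  ultimately show "infinite {n. active X n \<and> pfst n = i}" by (rule infinite_super[rotated])
qed

lemma always_verified_iff:
  "(\<forall>l. \<exists>t. verified i X l t) \<longleftrightarrow>
     (\<forall>\<sigma> n. phi (pfst i) (prod_encode (string_encode \<sigma>, n)) \<noteq> None) \<and>
     (\<forall>w. \<not> refuted (pfst i) (psnd i) X w)"
proof (intro iffI conjI allI)
  fix \<sigma> n assume *: "\<forall>l. \<exists>t. verified i X l t"
  obtain r where r: "initial_segment (bitseq r) (length \<sigma>) = \<sigma>" using string_eq_bitseq by blast
  \<comment> \<open>This bound exceeds the length, the index \<open>r\<close> and the precision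
    \<open>n\<close> at once.\<close>
  obtain t where "verified i X (Suc (length \<sigma> + r + n)) t" using * by blast
  then have "halted t (pfst i) (prod_encode (seg (bitseq r) (length \<sigma>), n))"
    unfolding verified_def by simp
  then show "phi (pfst i) (prod_encode (string_encode \<sigma>, n)) \<noteq> None"
    unfolding r by (rule halted_imp)
next
  fix w assume *: "\<forall>l. \<exists>t. verified i X l t"
  then obtain t where "verified i X (Suc w) t" by blast
  then show "\<not> refuted (pfst i) (psnd i) X w" unfolding verified_def by blast
next
  fix l assume *: "(\<forall>\<sigma> n. phi (pfst i) (prod_encode (string_encode \<sigma>, n)) \<noteq> None) \<and>
     (\<forall>w. \<not> refuted (pfst i) (psnd i) X w)"
  have "\<forall>\<^sub>F t in sequentially. \<forall>k\<in>{..<l}. \<forall>r\<in>{..<l}. \<forall>n\<in>{..<l}.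
    halted t (pfst i) (prod_encode (seg (bitseq r) k, n))"
    using * by (intro eventually_ball_finite ballI eventually_halted) simp_all
  then have "\<forall>\<^sub>F t in sequentially. verified i X l t"
    by eventually_elim (use * in \<open>simp add: verified_def\<close>)
  then show "\<exists>t. verified i X l t" unfolding eventually_sequentially by blast
qed

text \<open>Shows that the bound \<open>k < w\<close> in \<open>refuted\<close> loses no hits:
  \<open>k\<close> is at most the code of its segment, which lies below a stage that lies below
  \<open>w\<close>.\<close>

lemma hit_bound: "hit e c (seg X k) w \<Longrightarrow> k < w"
  using seg_ge[of k X] unfolding hit_def enumerated_def by fastforce

lemma infinite_active_imp_random:
  assumes "infinite {n. active X n \<and> pfst n = i}"
  shows "\<exists>\<mu>. mu (pfst i) = Some \<mu> \<and> ml_random \<mu> X"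
proof -
  have total: "phi (pfst i) (prod_encode (string_encode \<sigma>, n)) \<noteq> None"
    and unrefuted: "\<not> refuted (pfst i) (psnd i) X w" for \<sigma> n w
    using assms unfolding infinite_active_iff always_verified_iff by blast+
  have "\<not> conflict (pfst i) w" for w using unrefuted unfolding refuted_def by blast
  then obtain \<mu> where \<mu>: "computes_measure (phi (pfst i)) \<mu>"
    using no_conflict_imp_computes_measure[OF total] by blast
  have "\<not> hit (pfst i) (psnd i) (seg X k) w" for k w
    using unrefuted hit_bound unfolding refuted_def by blast
  then have "ml_random \<mu> X" by (rule no_hit_imp_ml_random[OF \<mu>])
  then show ?thesis using \<mu> by (auto simp: mu_eq_Some_iff)
qed

lemma random_imp_infinite_active:
  assumes \<mu>: "computes_measure (phi e) \<mu>" and "ml_random \<mu> X"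
  shows "\<exists>i. infinite {n. active X n \<and> pfst n = i}"
proof -
  obtain c where c: "\<And>k w. \<not> hit e c (seg X k) w" using ml_random_imp_no_hit[OF assms] by blast
  have "phi e (prod_encode (string_encode \<sigma>, n)) \<noteq> None" for \<sigma> n
    using \<mu> unfolding computes_measure_def by fastforce
  moreover have "\<not> refuted e c X w" for w
    unfolding refuted_def using computes_measure_imp_no_conflict[OF \<mu>] c by blast
  ultimately have "infinite {n. active X n \<and> pfst n = prod_encode (e, c)}"
    unfolding infinite_active_iff always_verified_iff by simp
  then show ?thesis by blast
qed

lemma injury_count_eq_card: "injury_count X i n = card {n'. n' < n \<and> pfst n' < i \<and> active X n'}"
proof -
  have "{n'. n' < n \<and> pfst n' < i \<and> active X n'} = {n' \<in> {..<n}. pfst n' < i \<and> active X n'}" by auto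
  then show ?thesis by (simp add: injury_count_def sum_of_bool_eq Int_def)
qed

section \<open>Convergence of the guesses\<close>

lemma guess_converges:
  assumes "\<exists>i. infinite {n. active X n \<and> pfst n = i}"
  shows "\<exists>i j. infinite {n. active X n \<and> pfst n = i} \<and> mu j = mu (pfst i) \<and>
    infinite {n. guess X n = j} \<and> (\<forall>j'. j' \<noteq> j \<longrightarrow> finite {n. guess X n = j'})"
proof -
  let ?A = "\<lambda>i. {n. active X n \<and> pfst n = i}"
  define i where "i = (LEAST i. infinite (?A i))"
  have inf: "infinite (?A i)" unfolding i_def using assms by (rule LeastI_ex)
  let ?F = "{n. pfst n < i \<and> active X n}"
  have "?F = (\<Union>i'<i. ?A i')" by auto
  moreover have "finite (?A i')" if "i' < i" for i' using not_less_Least[OF that[unfolded i_def]] by simp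
  ultimately have fin: "finite ?F" by simp
  then obtain N where N: "\<forall>n\<in>?F. n < N" unfolding finite_nat_set_iff_bounded by (rule exE)
  have stable: "injury_count X i n = card ?F" if "N \<le> n" for n
  proof -
    have "{n'. n' < n \<and> pfst n' < i \<and> active X n'} = ?F" using N that by force
    then show ?thesis by (simp add: injury_count_eq_card)
  qed
  let ?pad = "\<lambda>i k. pad (pfst i) (prod_encode (i, k))"
  let ?j = "?pad i (card ?F)"
  have "?A i - {..<N} \<subseteq> {n. guess X n = ?j}"
    using stable by (auto simp: guess_def)
  moreover have "infinite (?A i - {..<N})" using inf by (intro Diff_infinite_finite) simp_all
  ultimately have "infinite {n. guess X n = ?j}" by (rule infinite_super)
  moreover have "finite {n. guess X n = j'}" if "j' \<noteq> ?j" for j'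
  proof (rule ccontr)
    assume "infinite {n. guess X n = j'}"
    let ?S = "{n. active X n \<and> ?pad (pfst n) (injury_count X (pfst n) n) = j'}"
    have "{n. guess X n = j'} \<subseteq> insert j' ?S" by (auto simp: guess_def)
    from infinite_super[OF this \<open>infinite {n. guess X n = j'}\<close>] have S: "infinite ?S" by simp
    have unbounded: "\<exists>n\<in>?S. b \<le> n" for b
      using S unfolding infinite_nat_iff_unbounded_le by blast
    then obtain m where m: "m \<in> ?S" by blast
    let ?K = "injury_count X (pfst m) m"
    \<comment> \<open>Padding is injective, so a repeated output freezes both the pair and its
      count.\<close>
    have S_eq: "pfst n = pfst m \<and> injury_count X (pfst m) n = ?K" if "n \<in> ?S" for n
      using that m by (auto simp: pad_inject prod_encode_eq)
    then have "?S \<subseteq> ?A (pfst m)" by blast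
    then have "infinite (?A (pfst m))" using S by (rule infinite_super)
    then have "i \<le> pfst m" unfolding i_def by (rule Least_le)
    then consider "pfst m = i" | "i < pfst m" by linarith
    then show False
    proof cases
      case 1
      obtain n where n: "n \<in> ?S" "N \<le> n" using unbounded[of N] by (elim bexE)
      have "?K = injury_count X (pfst m) n" by (rule S_eq[OF n(1), THEN conjunct2, symmetric])
      also have "\<dots> = card ?F" unfolding 1 by (rule stable[OF n(2)])
      finally have "?pad (pfst m) ?K = ?j" by (simp only: 1)
      moreover have "?pad (pfst m) ?K = j'" using m by (elim CollectE conjE)
      ultimately show False using that by (simp only:)
    next
      case 2
      obtain T where T: "T \<subseteq> ?A i" "finite T" "card T = Suc ?K"
        using infinite_arbitrarily_large[OF inf] by blast
      obtain b where b: "\<forall>n\<in>T. n < b" using T(2) unfolding finite_nat_set_iff_bounded by (rule exE)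
      obtain n where n: "n \<in> ?S" "b \<le> n" using unbounded[of b] by (elim bexE)
      have "T \<subseteq> {n'. n' < n \<and> pfst n' < pfst m \<and> active X n'}"
        using T(1) b n(2) 2 by force
      then have "card T \<le> injury_count X (pfst m) n"
        unfolding injury_count_eq_card by (intro card_mono) auto
      then show False using S_eq[OF n(1)] T(3) by simp
    qed
  qed
  ultimately show ?thesis using inf mu_pad by blast
qed

theorem theorem1p8:
  shows "\<exists>L :: bool list \<Rightarrow> nat. computable_on_strings L \<and>
           (\<forall>\<mu>. computable_measure \<mu> \<longrightarrow> partially_succeeds L \<mu>)"
proof (intro exI conjI allI impI)
  show "computable_on_strings learner" by (rule computable_learner)
  fix \<mu> assume "computable_measure \<mu>"
  then obtain e where e: "computes_measure (phi e) \<mu>"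
    by (auto simp: computable_measure_iff_index mu_eq_Some_iff)
  show "partially_succeeds learner \<mu>"
    unfolding partially_succeeds_def learner_initial_segment
  proof (intro allI impI)
    fix X assume "ml_random \<mu> X"
    then obtain i j where ij: "infinite {n. active X n \<and> pfst n = i}" "mu j = mu (pfst i)"
      "infinite {n. guess X n = j}" "\<forall>j'. j' \<noteq> j \<longrightarrow> finite {n. guess X n = j'}"
      using guess_converges[OF random_imp_infinite_active[OF e]] by blast
    from infinite_active_imp_random[OF ij(1)]
    show "\<exists>j. infinite {n. guess X n = j} \<and> (\<forall>j'. j' \<noteq> j \<longrightarrow> finite {n. guess X n = j'}) \<and>
      (\<exists>\<nu>. mu j = Some \<nu> \<and> ml_random \<nu> X)"
      using ij(2-4) by (intro exI[of _ j]) simp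
  qed
qed

end
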